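(* In the setting of the context, for any exponents $\alpha,\beta,\gamma,\lambda\ge0$ with $\beta>2\lambda+1$, $$\limsup_{\mathsf{SNR}\to\infty}\frac{C_{\rm sum}(\mathsf{SNR})}{\log_2\mathsf{SNR}}\le\min\Big\{\max\{2,\,1+\min\{\beta,\gamma\}\},\ \max\{\alpha+\lambda,\ \beta,\ 1+\beta-\alpha-\lambda\}\Big\}.$$
   Context: Ergodic phase-fading Z-interference channel with a relay (Z-ICR): at each time $i$, $Y_{1,i}=H_{11,i}X_{1,i}+H_{21,i}X_{2,i}+H_{31,i}X_{3,i}+Z_{1,i}$, $Y_{2,i}=H_{22,i}X_{2,i}+H_{32,i}X_{3,i}+Z_{2,i}$, $Y_{3,i}=H_{13,i}X_{1,i}+Z_{3,i}$ (inputs of transmitter 1, transmitter 2, full-duplex relay; outputs at receiver 1, receiver 2, relay). Noises mutually independent, i.i.d. in time, $\mathcal{CN}(0,1)$, independent of everything else. $H_{lk,i}=\sqrt{\mathsf{SNR}_{lk}}e^{j\Theta_{lk,i}}$ with phases uniform on $[0,2\pi)$, independent across links and time and of all other variables. Per-symbol power constraints $\mathbb{E}|X_{k,i}|^2\le1$. Receiver 1 knows causally $(H_{11},H_{21},H_{31})$, receiver 2 knows $(H_{22},H_{32})$, relay knows $H_{13}$; no transmitter channel knowledge. Codes: independent uniform messages, deterministic encoders $x_k^n=e_k(m_k)$, relay $x_{3,i}=t_i(y_3^{i-1},h_{13}^{i-1})$, decoders using own output and own channel knowledge; achievability and capacity region $\mathcal{C}(\mathsf{SNR})$ (convex hull of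 achievable pairs) defined in the usual way with vanishing average error probability. SNR parametrization: $\mathsf{SNR}_{11}=\mathsf{SNR}_{22}=\mathsf{SNR}$, $\mathsf{SNR}_{21}=\mathsf{SNR}^{\alpha}$, $\mathsf{SNR}_{32}=\mathsf{SNR}^{\lambda}$, $\mathsf{SNR}_{13}=\mathsf{SNR}^{\gamma}$, $\mathsf{SNR}_{31}=\mathsf{SNR}^{\beta}$. $C_{\rm sum}(\mathsf{SNR})=\sup_{(R_1,R_2)\in\mathcal{C}(\mathsf{SNR})}(R_1+R_2)$ (bits). *)

theory Defs
  imports "HOL-Probability.Probability"
begin

text \<open>Links of the Z-ICR (l,k means from node l to node k): 11, 21, 31, 22, 32, 13.\<close>
datatype link = L11 | L21 | L31 | L22 | L32 | L13

text \<open>Receiving nodes: receiver 1, receiver 2, relay (3).\<close>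
datatype node = N1 | N2 | N3

text \<open>A code: message set sizes, encoders (message, time) to symbol, relay functions
  (time, past relay outputs, past relay channel gains), decoders.
  Messages are 0..<M. Sequences are indexed by time 0,1,...\<close>
record zcode =
  nmsg1 :: nat
  nmsg2 :: nat
  enc1 :: "nat \<Rightarrow> nat \<Rightarrow> complex"
  enc2 :: "nat \<Rightarrow> nat \<Rightarrow> complex"
  relayf :: "nat \<Rightarrow> (nat \<Rightarrow> complex) \<Rightarrow> (nat \<Rightarrow> complex) \<Rightarrow> complex"
  dec1 :: "(nat \<Rightarrow> complex) \<Rightarrow> (nat \<Rightarrow> complex) \<Rightarrow> (nat \<Rightarrow> complex) \<Rightarrow> (nat \<Rightarrow> complex) \<Rightarrow> nat"
  dec2 :: "(nat \<Rightarrow> complex) \<Rightarrow> (nat \<Rightarrow> complex) \<Rightarrow> (nat \<Rightarrow> complex) \<Rightarrow> nat"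

text \<open>Randomness at each time: phases of all links and noises at all nodes.\<close>
type_synonym sample = "nat \<Rightarrow> (link \<Rightarrow> real) \<times> (node \<Rightarrow> complex)"

definition phase_meas :: "real measure" where
  "phase_meas = uniform_measure lborel {0..<2*pi}"

definition cn_meas :: "complex measure" where
  "cn_meas = density lborel (\<lambda>z. ennreal (exp (- ((cmod z)^2)) / pi))"

definition sym_meas :: "((link \<Rightarrow> real) \<times> (node \<Rightarrow> complex)) measure" where
  "sym_meas = (PiM UNIV (\<lambda>_::link. phase_meas)) \<Otimes>\<^sub>M (PiM UNIV (\<lambda>_::node. cn_meas))"

definition block_meas :: "nat \<Rightarrow> sample measure" where
  "block_meas n = PiM {..<n} (\<lambda>_. sym_meas)"

definition trunc :: "nat \<Rightarrow> (nat \<Rightarrow> complex) \<Rightarrow> nat \<Rightarrow> complex" where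
  "trunc k f = (\<lambda>j. if j < k then f j else 0)"

definition gain :: "(link \<Rightarrow> real) \<Rightarrow> link \<Rightarrow> sample \<Rightarrow> nat \<Rightarrow> complex" where
  "gain snr l \<omega> i = complex_of_real (sqrt (snr l)) * cis (fst (\<omega> i) l)"

definition noise :: "node \<Rightarrow> sample \<Rightarrow> nat \<Rightarrow> complex" where
  "noise k \<omega> i = snd (\<omega> i) k"

definition relay_in :: "zcode \<Rightarrow> (link \<Rightarrow> real) \<Rightarrow> nat \<Rightarrow> sample \<Rightarrow> nat \<Rightarrow> complex" where
  "relay_in c snr m1 \<omega> i = gain snr L13 \<omega> i * enc1 c m1 i + noise N3 \<omega> i"

definition relay_out :: "zcode \<Rightarrow> (link \<Rightarrow> real) \<Rightarrow> nat \<Rightarrow> sample \<Rightarrow> nat \<Rightarrow> complex" where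
  "relay_out c snr m1 \<omega> i =
     relayf c i (trunc i (relay_in c snr m1 \<omega>)) (trunc i (gain snr L13 \<omega>))"

definition out1 :: "zcode \<Rightarrow> (link \<Rightarrow> real) \<Rightarrow> nat \<Rightarrow> nat \<Rightarrow> sample \<Rightarrow> nat \<Rightarrow> complex" where
  "out1 c snr m1 m2 \<omega> i =
     gain snr L11 \<omega> i * enc1 c m1 i + gain snr L21 \<omega> i * enc2 c m2 i
     + gain snr L31 \<omega> i * relay_out c snr m1 \<omega> i + noise N1 \<omega> i"

definition out2 :: "zcode \<Rightarrow> (link \<Rightarrow> real) \<Rightarrow> nat \<Rightarrow> nat \<Rightarrow> sample \<Rightarrow> nat \<Rightarrow> complex" where
  "out2 c snr m1 m2 \<omega> i =
     gain snr L22 \<omega> i * enc2 c m2 i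
     + gain snr L32 \<omega> i * relay_out c snr m1 \<omega> i + noise N2 \<omega> i"

definition est1 :: "zcode \<Rightarrow> (link \<Rightarrow> real) \<Rightarrow> nat \<Rightarrow> nat \<Rightarrow> nat \<Rightarrow> sample \<Rightarrow> nat" where
  "est1 c snr n m1 m2 \<omega> =
     dec1 c (trunc n (out1 c snr m1 m2 \<omega>)) (trunc n (gain snr L11 \<omega>))
            (trunc n (gain snr L21 \<omega>)) (trunc n (gain snr L31 \<omega>))"

definition est2 :: "zcode \<Rightarrow> (link \<Rightarrow> real) \<Rightarrow> nat \<Rightarrow> nat \<Rightarrow> nat \<Rightarrow> sample \<Rightarrow> nat" where
  "est2 c snr n m1 m2 \<omega> =
     dec2 c (trunc n (out2 c snr m1 m2 \<omega>)) (trunc n (gain snr L22 \<omega>))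
            (trunc n (gain snr L32 \<omega>))"

text \<open>Admissible code of block length n: per-symbol power constraints (expectation over
  the uniform message and, for the relay, the channel randomness) and measurability
  of the relay signals and decoder outputs.\<close>
definition valid_code :: "(link \<Rightarrow> real) \<Rightarrow> nat \<Rightarrow> zcode \<Rightarrow> bool" where
  "valid_code snr n c \<longleftrightarrow>
     nmsg1 c \<ge> 1 \<and> nmsg2 c \<ge> 1 \<and>
     (\<forall>i<n. (\<Sum>m<nmsg1 c. (cmod (enc1 c m i))^2) \<le> real (nmsg1 c)) \<and>
     (\<forall>i<n. (\<Sum>m<nmsg2 c. (cmod (enc2 c m i))^2) \<le> real (nmsg2 c)) \<and>
     (\<forall>m<nmsg1 c. \<forall>i<n. (\<lambda>\<omega>. relay_out c snr m \<omega> i) \<in> borel_measurable (block_meas n)) \<and>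
     (\<forall>i<n. (\<Sum>m<nmsg1 c. \<integral>\<^sup>+\<omega>. ennreal ((cmod (relay_out c snr m \<omega> i))^2) \<partial>block_meas n)
              \<le> ennreal (real (nmsg1 c))) \<and>
     (\<forall>m1<nmsg1 c. \<forall>m2<nmsg2 c.
        est1 c snr n m1 m2 \<in> measurable (block_meas n) (count_space UNIV) \<and>
        est2 c snr n m1 m2 \<in> measurable (block_meas n) (count_space UNIV))"

definition err_prob :: "(link \<Rightarrow> real) \<Rightarrow> nat \<Rightarrow> zcode \<Rightarrow> real" where
  "err_prob snr n c =
     (\<Sum>m1<nmsg1 c. \<Sum>m2<nmsg2 c.
        measure (block_meas n)
          {\<omega> \<in> space (block_meas n). est1 c snr n m1 m2 \<omega> \<noteq> m1 \<or> est2 c snr n m1 m2 \<omega> \<noteq> m2})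
     / (real (nmsg1 c) * real (nmsg2 c))"

definition achievable :: "(link \<Rightarrow> real) \<Rightarrow> real \<Rightarrow> real \<Rightarrow> bool" where
  "achievable snr R1 R2 \<longleftrightarrow> R1 \<ge> 0 \<and> R2 \<ge> 0 \<and>
     (\<forall>\<epsilon>>0. \<exists>N. \<forall>n\<ge>N. \<exists>c. valid_code snr n c \<and>
        nmsg1 c = nat \<lceil>2 powr (real n * R1)\<rceil> \<and> nmsg2 c = nat \<lceil>2 powr (real n * R2)\<rceil> \<and>
        err_prob snr n c \<le> \<epsilon>)"

definition capacity_region :: "(link \<Rightarrow> real) \<Rightarrow> (real \<times> real) set" where
  "capacity_region snr = convex hull {(R1, R2). achievable snr R1 R2}"

definition Csum :: "(link \<Rightarrow> real) \<Rightarrow> ereal" where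
  "Csum snr = (SUP p \<in> capacity_region snr. ereal (fst p + snd p))"

definition zicr_snr :: "real \<Rightarrow> real \<Rightarrow> real \<Rightarrow> real \<Rightarrow> real \<Rightarrow> link \<Rightarrow> real" where
  "zicr_snr s \<alpha> \<beta> \<gamma> lam l = (case l of
      L11 \<Rightarrow> s | L22 \<Rightarrow> s | L21 \<Rightarrow> s powr \<alpha> | L32 \<Rightarrow> s powr lam
    | L13 \<Rightarrow> s powr \<gamma> | L31 \<Rightarrow> s powr \<beta>)"

end

theory Submission
  imports Defs
begin

text \<open>
  The converse uses change of measure instead of entropies. Condition on all phases and on part of the noise,
  and let \<open>p\<^sub>m\<close> be the density of what a receiver observes when message \<open>m\<close> is sent. For every probability density \<open>q\<close>,
  the sum over \<open>m\<close> of the expectations of \<open>q / p\<^sub>m\<close> on the event of correct decoding is at most 1. If \<open>q / p\<^sub>m\<close>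
  exceeds \<open>1 / K\<close> whenever the total energy of the block is at most linear in the block length, then up to a constant factor
  there are at most \<open>K\<close> messages.

  Suitable Gaussian \<open>q\<close> bound the two rates separately and give the first term of the minimum. For the second term,
  receiver 2 is also given the interference \<open>S = H21 X2 + Z1\<close>, while \<open>q\<close> is a Gaussian mixture around the points \<open>H31 X3\<close> at
  receiver 1, and at receiver 2 it is the law of \<open>S\<close> times a Gaussian in \<open>Y2 - (H22 / H21) S\<close>. In the product of the two ratios
  the law of \<open>S\<close> cancels, and the mixture at receiver 1 dominates the mixture law of \<open>H32 X3 + Z2\<close> term by term, up to the factor
  \<open>SNR powr max \<alpha> (\<beta> - \<lambda>)\<close> per symbol.
\<close>

section \<open>Gaussian densities and product measures\<close>

text \<open>Two laws stand in the way of the second term: that of the interference \<open>S\<close>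
  and that of \<open>H32 X3 + Z2\<close>. Both are mixtures over an arbitrary codebook, so neither
  receiver's ratio has a useful lower bound of its own. The test densities are built so that one
  unknown law cancels in the product and the other is met by a mixture over the same messages. Since
  only the product is controlled, while change of measure bounds each ratio separately, the two are
  joined by the inequality of arithmetic and geometric means.

  The restriction to moderate energy is forced by the power constraints, which bound second moments
  only: on rare blocks of huge energy the ratio \<open>q / p\<close> may be arbitrarily small.
  Markov's inequality removes those blocks. What remains costs a factor
  \<open>exp (const * n)\<close> with a constant independent of the SNR, which disappears after
  division by the logarithm of the SNR.

  Each message carries a label, the part of it that the receiver must decode. For the sum rate the
  message is a pair and the label one component; the other component is averaged out inside the
  denominator.\<close>

definition gden :: "real \<Rightarrow> complex \<Rightarrow> real" where
  "gden v z = exp (- (cmod z)\<^sup>2 / v) / (pi * v)"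

lemma gden_pos: "v > 0 \<Longrightarrow> gden v z > 0"
  by (simp add: gden_def)

lemma gden_measurable [measurable]: "gden v \<in> borel_measurable borel"
  unfolding gden_def by measurable

lemma nn_integral_gden:
  assumes v: "v > 0"
  shows "(\<integral>\<^sup>+z. ennreal (gden v z) \<partial>lborel) = 1"
proof -
  \<comment> \<open>The parameter \<open>v\<close> is the total variance of a circularly symmetric
    Gaussian, so each real coordinate has variance \<open>v/2\<close>.\<close>
  let ?d = "normal_density 0 (sqrt (v/2))"
  have eq: "ennreal (gden v z) = (\<Prod>b\<in>Basis. ennreal (?d (z \<bullet> b)))" for z :: complex
  proof -
    have "gden v z = ?d (Re z) * ?d (Im z)"
    proof -
      have "?d (Re z) * ?d (Im z) = exp (- (Re z)\<^sup>2 / v) * exp (- (Im z)\<^sup>2 / v) / (sqrt (pi * v) * sqrt (pi * v))"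
        using v by (simp add: normal_density_def)
      also have "\<dots> = gden v z"
        using v by (simp add: gden_def cmod_power2 diff_divide_distrib flip: exp_add)
      finally show ?thesis ..
    qed
    then show ?thesis
      by (simp add: Basis_complex_def complex_inner_1_right complex_inner_i_right ennreal_mult complex_eq_iff)
  qed
  have "emeasure (density lborel ?d) (space (density lborel ?d)) = 1"
    using v by (intro prob_space.emeasure_space_1 prob_space_normal_density) simp
  then have "(\<integral>\<^sup>+x. ennreal (?d x) \<partial>lborel) = 1"
    by (simp add: emeasure_density)
  then show ?thesis
    unfolding eq by (subst nn_integral_lborel_prod) auto
qed

lemma nn_integral_lborel_translate:
  fixes f :: "'a::euclidean_space \<Rightarrow> ennreal"
  assumes [measurable]: "f \<in> borel_measurable borel"
  shows "(\<integral>\<^sup>+z. f (z + s) \<partial>lborel) = (\<integral>\<^sup>+z. f z \<partial>lborel)"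
proof -
  have "(\<integral>\<^sup>+z. f z \<partial>lborel) = (\<integral>\<^sup>+z. f z \<partial>distr lborel borel ((+) s))"
    by (simp add: lborel_distr_plus)
  also have "\<dots> = (\<integral>\<^sup>+z. f (z + s) \<partial>lborel)"
    by (subst nn_integral_distr) (auto simp: add.commute)
  finally show ?thesis ..
qed

lemma nn_integral_gden_translate:
  "v > 0 \<Longrightarrow> (\<integral>\<^sup>+z. ennreal (gden v (z - m)) \<partial>lborel) = 1"
  using nn_integral_lborel_translate[of "\<lambda>z. ennreal (gden v z)" "- m"] nn_integral_gden[of v] by simp

lemma cn_meas_eq: "cn_meas = density lborel (\<lambda>z. ennreal (gden 1 z))"
  by (simp add: cn_meas_def gden_def)

lemma sets_cn_meas [measurable_cong, simp]: "sets cn_meas = sets borel"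
  by (simp add: cn_meas_def)

lemma space_cn_meas [simp]: "space cn_meas = UNIV"
  by (simp add: cn_meas_def)

lemma prob_space_cn_meas: "prob_space cn_meas"
  by (rule prob_spaceI) (simp add: cn_meas_eq emeasure_density nn_integral_gden)

interpretation cn: prob_space cn_meas by (rule prob_space_cn_meas)

lemma prob_space_phase_meas: "prob_space phase_meas"
  unfolding phase_meas_def by (rule prob_space_uniform_measure) auto

lemma sets_phase_meas [measurable_cong, simp]: "sets phase_meas = sets borel"
  by (simp add: phase_meas_def)

lemma cn_meas_translate:
  "distr cn_meas lborel (\<lambda>z. z + s) = density lborel (\<lambda>y. ennreal (gden 1 (y - s)))"
proof (rule measure_eqI)
  fix A assume "A \<in> sets (distr cn_meas lborel (\<lambda>z. z + s))"
  then have [measurable]: "A \<in> sets borel" by simp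
  have "emeasure (distr cn_meas lborel (\<lambda>z. z + s)) A
      = (\<integral>\<^sup>+z. ennreal (gden 1 ((z + s) - s)) * indicator A (z + s) \<partial>lborel)"
  proof (subst emeasure_distr)
    have "(\<lambda>z. z + s) -` A \<in> sets borel"
      using measurable_sets[of "\<lambda>z. z + s" borel borel A] by simp
    then show "emeasure cn_meas ((\<lambda>z. z + s) -` A \<inter> space cn_meas)
        = (\<integral>\<^sup>+z. ennreal (gden 1 ((z + s) - s)) * indicator A (z + s) \<partial>lborel)"
      unfolding cn_meas_eq by (subst emeasure_density) (auto simp: indicator_def intro!: nn_integral_cong)
  qed (auto simp: cn_meas_eq)
  also have "\<dots> = (\<integral>\<^sup>+z. ennreal (gden 1 (z - s)) * indicator A z \<partial>lborel)"
    by (rule nn_integral_lborel_translate) measurable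
  finally show "emeasure (distr cn_meas lborel (\<lambda>z. z + s)) A
      = emeasure (density lborel (\<lambda>y. ennreal (gden 1 (y - s)))) A"
    by (simp add: emeasure_density)
qed simp

text \<open>Trading \<open>t\<close> for \<open>2 * exp (t/2)\<close> turns the weighted density
  into four times a Gaussian density of variance 2. The exact moment is 1, but any finite constant
  serves the energy estimate.\<close>

lemma cn_meas_second_moment: "(\<integral>\<^sup>+z. ennreal ((cmod z)\<^sup>2) \<partial>cn_meas) \<le> 4"
proof -
  have le: "gden 1 z * (cmod z)\<^sup>2 \<le> 4 * gden 2 z" for z
  proof -
    let ?t = "(cmod z)\<^sup>2"
    have "?t \<le> 2 * exp (?t / 2)" using exp_ge_add_one_self[of "?t/2"] by linarith
    then have "exp (- ?t) * ?t \<le> exp (- ?t) * (2 * exp (?t / 2))"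
      by (intro mult_left_mono) auto
    also have "\<dots> = 2 * exp (- ?t / 2)" by (simp flip: exp_add)
    finally show ?thesis by (simp add: gden_def divide_right_mono)
  qed
  have "(\<integral>\<^sup>+z. ennreal ((cmod z)\<^sup>2) \<partial>cn_meas) = (\<integral>\<^sup>+z. ennreal (gden 1 z * (cmod z)\<^sup>2) \<partial>lborel)"
    unfolding cn_meas_eq by (subst nn_integral_density) (auto simp: ennreal_mult' gden_pos less_imp_le)
  also have "\<dots> \<le> (\<integral>\<^sup>+z. 4 * ennreal (gden 2 z) \<partial>lborel)"
    using le by (intro nn_integral_mono) (metis ennreal_leI ennreal_mult' ennreal_numeral zero_le_numeral)
  also have "\<dots> = 4"
    by (subst nn_integral_cmult) (auto simp: nn_integral_gden)
  finally show ?thesis .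
qed

text \<open>Both sides are compared with the product of the one-dimensional densities, on boxes. The
  lemma is applied twice: over the nodes of one symbol, then over the symbols of a block.\<close>

lemma distr_PiM_density:
  fixes N B :: "'i \<Rightarrow> 'a measure"
  assumes I: "finite I" and N: "\<And>i. prob_space (N i)" and B: "\<And>i. sigma_finite_measure (B i)"
    and T: "\<And>i. T i \<in> measurable (N i) (B i)" and f [measurable]: "\<And>i. f i \<in> borel_measurable (B i)"
    and eq: "\<And>i. distr (N i) (B i) (T i) = density (B i) (f i)"
  shows "distr (PiM I N) (PiM I B) (\<lambda>z. \<lambda>i\<in>I. T i (z i)) = density (PiM I B) (\<lambda>y. \<Prod>i\<in>I. f i (y i))"
proof -
  interpret N: product_prob_space N I
    using N by (simp add: product_prob_space_def product_sigma_finite_def product_prob_space_axioms_def prob_space_imp_sigma_finite)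
  interpret B: product_sigma_finite B
    using B by (simp add: product_sigma_finite_def)
  have prob: "prob_space (density (B i) (f i))" for i
    using prob_space.prob_space_distr[OF N T] eq by metis
  interpret D: product_sigma_finite "\<lambda>i. density (B i) (f i)"
    using prob by (simp add: product_sigma_finite_def prob_space_imp_sigma_finite)
  have s: "sets (PiM I B) = sets (PiM I (\<lambda>i. density (B i) (f i)))"
    by (intro sets_PiM_cong) auto
  have [measurable]: "(\<lambda>z. \<lambda>i\<in>I. T i (z i)) \<in> measurable (PiM I N) (PiM I B)"
    using T by (intro measurable_restrict measurable_compose[OF measurable_component_singleton])
  have "distr (PiM I N) (PiM I B) (\<lambda>z. \<lambda>i\<in>I. T i (z i)) = PiM I (\<lambda>i. density (B i) (f i))"
  proof (rule D.PiM_eqI[OF I])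
    fix A assume "\<And>i. i \<in> I \<Longrightarrow> A i \<in> sets (density (B i) (f i))"
    then have A: "\<And>i. i \<in> I \<Longrightarrow> A i \<in> sets (B i)" by simp
    have "emeasure (distr (PiM I N) (PiM I B) (\<lambda>z. \<lambda>i\<in>I. T i (z i))) (Pi\<^sub>E I A)
        = emeasure (PiM I N) ((\<lambda>z. \<lambda>i\<in>I. T i (z i)) -` Pi\<^sub>E I A \<inter> space (PiM I N))"
      using I A by (intro emeasure_distr) (auto intro!: sets_PiM_I_finite)
    also have "(\<lambda>z. \<lambda>i\<in>I. T i (z i)) -` Pi\<^sub>E I A \<inter> space (PiM I N) = Pi\<^sub>E I (\<lambda>i. T i -` A i \<inter> space (N i))"
      by (auto simp: space_PiM PiE_iff)
    also have "emeasure (PiM I N) \<dots> = (\<Prod>i\<in>I. emeasure (N i) (T i -` A i \<inter> space (N i)))"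
      using A T I by (intro N.emeasure_PiM) (auto intro: measurable_sets)
    also have "\<dots> = (\<Prod>i\<in>I. emeasure (density (B i) (f i)) (A i))"
      using A T by (intro prod.cong refl) (simp add: emeasure_distr flip: eq)
    finally show "emeasure (distr (PiM I N) (PiM I B) (\<lambda>z. \<lambda>i\<in>I. T i (z i))) (Pi\<^sub>E I A)
      = (\<Prod>i\<in>I. emeasure (density (B i) (f i)) (A i))" .
  qed (simp add: s)
  also have "\<dots> = density (PiM I B) (\<lambda>y. \<Prod>i\<in>I. f i (y i))"
  proof (rule D.PiM_eqI[OF I, symmetric])
    fix A assume "\<And>i. i \<in> I \<Longrightarrow> A i \<in> sets (density (B i) (f i))"
    then have A: "\<And>i. i \<in> I \<Longrightarrow> A i \<in> sets (B i)" by simp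
    have [measurable]: "(\<lambda>y. \<Prod>i\<in>I. f i (y i)) \<in> borel_measurable (PiM I B)"
      by (intro borel_measurable_prod_ennreal) simp
    have "emeasure (density (PiM I B) (\<lambda>y. \<Prod>i\<in>I. f i (y i))) (Pi\<^sub>E I A)
        = (\<integral>\<^sup>+y. (\<Prod>i\<in>I. f i (y i)) * indicator (Pi\<^sub>E I A) y \<partial>PiM I B)"
      using I A by (intro emeasure_density) (auto intro!: sets_PiM_I_finite)
    also have "\<dots> = (\<integral>\<^sup>+y. (\<Prod>i\<in>I. f i (y i) * indicator (A i) (y i)) \<partial>PiM I B)"
    proof (intro nn_integral_cong)
      fix y assume "y \<in> space (PiM I B)"
      then have "indicator (Pi\<^sub>E I A) y = (\<Prod>i\<in>I. indicator (A i) (y i) :: ennreal)"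
        using I by (auto simp: indicator_def space_PiM PiE_iff)
      then show "(\<Prod>i\<in>I. f i (y i)) * indicator (Pi\<^sub>E I A) y = (\<Prod>i\<in>I. f i (y i) * indicator (A i) (y i))"
        by (simp add: prod.distrib)
    qed
    also have "\<dots> = (\<Prod>i\<in>I. emeasure (density (B i) (f i)) (A i))"
      using I A by (subst B.product_nn_integral_prod) (auto simp: emeasure_density)
    finally show "emeasure (density (PiM I B) (\<lambda>y. \<Prod>i\<in>I. f i (y i))) (Pi\<^sub>E I A)
      = (\<Prod>i\<in>I. emeasure (density (B i) (f i)) (A i))" .
  qed (simp add: s)
  finally show ?thesis .
qed

text \<open>On a box the integrand factors over the coordinates, so a kernel that preserves the law
  of a single symbol (\<open>pres\<close>) preserves the law of the block when applied independently
  in each symbol.\<close>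

lemma nn_integral_PiM_resample:
  fixes M :: "'a measure" and N :: "'b measure"
  assumes I: "finite I" and M: "prob_space M" and N: "prob_space N"
    and T: "case_prod T \<in> measurable (M \<Otimes>\<^sub>M N) M"
    and pres: "\<And>f. f \<in> borel_measurable M \<Longrightarrow> (\<integral>\<^sup>+x. \<integral>\<^sup>+z. f (T x z) \<partial>N \<partial>M) = (\<integral>\<^sup>+x. f x \<partial>M)"
    and f [measurable]: "f \<in> borel_measurable (PiM I (\<lambda>_. M))"
  shows "(\<integral>\<^sup>+x. f x \<partial>PiM I (\<lambda>_. M))
    = (\<integral>\<^sup>+x. \<integral>\<^sup>+z. f (\<lambda>i\<in>I. T (x i) (z i)) \<partial>PiM I (\<lambda>_. N) \<partial>PiM I (\<lambda>_. M))"
proof -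
  interpret M: product_prob_space "\<lambda>_. M" I
    using M by (simp add: product_prob_space_def product_sigma_finite_def product_prob_space_axioms_def prob_space_imp_sigma_finite)
  interpret N: product_prob_space "\<lambda>_. N" I
    using N by (simp add: product_prob_space_def product_sigma_finite_def product_prob_space_axioms_def prob_space_imp_sigma_finite)
  have PN: "sigma_finite_measure (PiM I (\<lambda>_. N))" by (rule prob_space_imp_sigma_finite) unfold_locales
  let ?P = "PiM I (\<lambda>_. M)" and ?Q = "PiM I (\<lambda>_. N)"
  let ?T = "\<lambda>p. \<lambda>i\<in>I. T (fst p i) (snd p i)"
  note T' = T[unfolded split_beta']
  have [measurable]: "?T \<in> measurable (?P \<Otimes>\<^sub>M ?Q) ?P"
  proof (rule measurable_restrict)
    fix i assume "i \<in> I"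
    then have "(\<lambda>p. (fst p i, snd p i)) \<in> measurable (?P \<Otimes>\<^sub>M ?Q) (M \<Otimes>\<^sub>M N)"
      by (intro measurable_Pair measurable_compose[OF measurable_fst] measurable_compose[OF measurable_snd]
          measurable_component_singleton)
    from measurable_compose[OF this T] show "(\<lambda>p. T (fst p i) (snd p i)) \<in> measurable (?P \<Otimes>\<^sub>M ?Q) M"
      by simp
  qed
  have "distr (?P \<Otimes>\<^sub>M ?Q) ?P ?T = ?P"
  proof (rule M.PiM_eqI[OF I])
    fix A assume A: "\<And>i. i \<in> I \<Longrightarrow> A i \<in> sets M"
    have mT [measurable]: "(\<lambda>x. \<integral>\<^sup>+z. indicator (A i) (T x z) \<partial>N) \<in> borel_measurable M" if "i \<in> I" for i
    proof -
      have "(\<lambda>p. indicator (A i) (T (fst p) (snd p)) :: ennreal) \<in> borel_measurable (M \<Otimes>\<^sub>M N)"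
        using measurable_compose[OF T' borel_measurable_indicator[OF A[OF that]]] .
      then show ?thesis
        by (intro sigma_finite_measure.borel_measurable_nn_integral prob_space_imp_sigma_finite N) (simp add: split_beta')
    qed
    have mTz: "(\<lambda>z. indicator (A i) (T x z) :: ennreal) \<in> borel_measurable N" if "i \<in> I" "x \<in> space M" for i x
      using measurable_compose[OF measurable_compose[OF measurable_Pair1'[OF that(2)] T] 
          borel_measurable_indicator[OF A[OF that(1)]]] by simp
    have "emeasure (distr (?P \<Otimes>\<^sub>M ?Q) ?P ?T) (Pi\<^sub>E I A) = (\<integral>\<^sup>+p. indicator (Pi\<^sub>E I A) (?T p) \<partial>(?P \<Otimes>\<^sub>M ?Q))"
      using A I by (subst nn_integral_distr[symmetric, where f="indicator (Pi\<^sub>E I A)" and M'="?P"]) (auto intro!: sets_PiM_I_finite)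
    also have "\<dots> = (\<integral>\<^sup>+x. \<integral>\<^sup>+z. indicator (Pi\<^sub>E I A) (?T (x, z)) \<partial>?Q \<partial>?P)"
      using A I by (intro sigma_finite_measure.nn_integral_fst[OF PN, symmetric]) (auto intro!: sets_PiM_I_finite)
    also have "\<dots> = (\<integral>\<^sup>+x. \<integral>\<^sup>+z. (\<Prod>i\<in>I. indicator (A i) (T (x i) (z i))) \<partial>?Q \<partial>?P)"
      using I by (intro nn_integral_cong) (auto simp: indicator_def PiE_iff)
    also have "\<dots> = (\<integral>\<^sup>+x. (\<Prod>i\<in>I. \<integral>\<^sup>+z. indicator (A i) (T (x i) z) \<partial>N) \<partial>?P)"
      using mTz I by (intro nn_integral_cong N.product_nn_integral_prod[where f="\<lambda>i z. indicator (A i) (T (_ i) z)"])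
        (auto simp: space_PiM PiE_iff)
    also have "\<dots> = (\<Prod>i\<in>I. \<integral>\<^sup>+x. \<integral>\<^sup>+z. indicator (A i) (T x z) \<partial>N \<partial>M)"
      using mT I by (intro M.product_nn_integral_prod) auto
    also have "\<dots> = (\<Prod>i\<in>I. emeasure M (A i))"
      using A by (intro prod.cong refl) (subst pres, auto)
    finally show "emeasure (distr (?P \<Otimes>\<^sub>M ?Q) ?P ?T) (Pi\<^sub>E I A) = (\<Prod>i\<in>I. emeasure M (A i))" .
  qed simp
  then have "(\<integral>\<^sup>+x. f x \<partial>?P) = (\<integral>\<^sup>+x. f x \<partial>distr (?P \<Otimes>\<^sub>M ?Q) ?P ?T)" by simp
  also have "\<dots> = (\<integral>\<^sup>+p. f (?T p) \<partial>(?P \<Otimes>\<^sub>M ?Q))"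
    by (rule nn_integral_distr) auto
  also have "\<dots> = (\<integral>\<^sup>+x. \<integral>\<^sup>+z. f (?T (x, z)) \<partial>?Q \<partial>?P)"
    by (intro sigma_finite_measure.nn_integral_fst[OF PN, symmetric]) measurable
  finally show ?thesis by simp
qed

section \<open>Translation and resampling of the noise\<close>

lemma finite_node_set [simp]: "finite (K :: node set)"
  by (rule finite_subset[of _ "{N1, N2, N3}"]) (auto intro: node.exhaust)

lemma prob_space_PiM_cn: "prob_space (PiM K (\<lambda>_. cn_meas))"
  by (rule prob_space_PiM) (rule prob_space_cn_meas)

lemma prob_space_PiM_phase: "prob_space (PiM K (\<lambda>_. phase_meas))"
  by (rule prob_space_PiM) (rule prob_space_phase_meas)

lemma prob_space_sym_meas: "prob_space sym_meas"
proof -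
  interpret A: prob_space "PiM UNIV (\<lambda>_::link. phase_meas)" by (rule prob_space_PiM_phase)
  interpret B: prob_space "PiM UNIV (\<lambda>_::node. cn_meas)" by (rule prob_space_PiM_cn)
  interpret pair_prob_space "PiM UNIV (\<lambda>_::link. phase_meas)" "PiM UNIV (\<lambda>_::node. cn_meas)" ..
  show ?thesis unfolding sym_meas_def by unfold_locales
qed

lemma prob_space_block_meas: "prob_space (block_meas n)"
  unfolding block_meas_def by (rule prob_space_PiM) (rule prob_space_sym_meas)

definition noise_meas :: "nat \<Rightarrow> node set \<Rightarrow> (nat \<Rightarrow> node \<Rightarrow> complex) measure" where
  "noise_meas n K = PiM {..<n} (\<lambda>_. PiM K (\<lambda>_. cn_meas))"

definition leb_meas :: "nat \<Rightarrow> node set \<Rightarrow> (nat \<Rightarrow> node \<Rightarrow> complex) measure" where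
  "leb_meas n K = PiM {..<n} (\<lambda>_. PiM K (\<lambda>_. lborel))"

definition translate :: "nat \<Rightarrow> node set \<Rightarrow> (nat \<Rightarrow> node \<Rightarrow> complex) \<Rightarrow> (nat \<Rightarrow> node \<Rightarrow> complex) \<Rightarrow> nat \<Rightarrow> node \<Rightarrow> complex" where
  "translate n K s z = (\<lambda>i\<in>{..<n}. \<lambda>k\<in>K. z i k + s i k)"

definition noise_dens :: "nat \<Rightarrow> node set \<Rightarrow> (nat \<Rightarrow> node \<Rightarrow> complex) \<Rightarrow> real" where
  "noise_dens n K z = (\<Prod>i<n. \<Prod>k\<in>K. gden 1 (z i k))"

text \<open>Conditioning is encoded as resampling: the noise at the nodes in \<open>K\<close> is
  replaced by a fresh copy while all phases and the other noise stay. For fixed \<omega> the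
  integral over \<open>z\<close> then plays the role of the conditional expectation given everything
  outside \<open>K\<close>, and no conditional laws have to be constructed.\<close>

definition resample_symbol ::
  "node set \<Rightarrow> (link \<Rightarrow> real) \<times> (node \<Rightarrow> complex) \<Rightarrow> (node \<Rightarrow> complex) \<Rightarrow> (link \<Rightarrow> real) \<times> (node \<Rightarrow> complex)" where
  "resample_symbol K x z = (fst x, \<lambda>k. if k \<in> K then z k else snd x k)"

definition resample :: "nat \<Rightarrow> node set \<Rightarrow> sample \<Rightarrow> (nat \<Rightarrow> node \<Rightarrow> complex) \<Rightarrow> sample" where
  "resample n K \<omega> z = (\<lambda>i\<in>{..<n}. resample_symbol K (\<omega> i) (z i))"

lemma noise_dens_pos: "noise_dens n K z > 0"
  unfolding noise_dens_def by (intro prod_pos ballI gden_pos) simp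

lemma sets_noise_meas [measurable_cong, simp]: "sets (noise_meas n K) = sets (leb_meas n K)"
  unfolding noise_meas_def leb_meas_def by (intro sets_PiM_cong refl) simp

lemma space_noise_meas [simp]: "space (noise_meas n K) = space (leb_meas n K)"
  by (rule sets_eq_imp_space_eq) simp

lemma space_leb_meas: "space (leb_meas n K) = ({..<n} \<rightarrow>\<^sub>E (K \<rightarrow>\<^sub>E UNIV))"
  by (simp add: leb_meas_def space_PiM)

lemma leb_component_measurable:
  "i < n \<Longrightarrow> k \<in> K \<Longrightarrow> (\<lambda>y. y i k) \<in> borel_measurable (leb_meas n K)"
  unfolding leb_meas_def
  by (rule measurable_compose[OF measurable_component_singleton[of i] measurable_component_singleton[of k, where M="\<lambda>_. lborel", simplified]])
    auto

lemma translate_measurable [measurable]: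
  "translate n K s \<in> measurable (leb_meas n K) (leb_meas n K)"
  unfolding translate_def [abs_def]
  by (subst (2) leb_meas_def) (intro measurable_restrict, auto intro!: leb_component_measurable borel_measurable_add)

lemma noise_dens_measurable [measurable]:
  "(\<lambda>y. noise_dens n K (\<lambda>i k. y i k - s i k)) \<in> borel_measurable (leb_meas n K)"
  unfolding noise_dens_def
  by (intro borel_measurable_prod measurable_compose[OF _ gden_measurable] borel_measurable_diff leb_component_measurable) auto

lemma product_sigma_finite_lborel: "product_sigma_finite (\<lambda>_. lborel)"
  by unfold_locales

lemma sigma_finite_PiM_lborel: "finite K \<Longrightarrow> sigma_finite_measure (PiM K (\<lambda>_. lborel))"
  by (intro product_sigma_finite.sigma_finite product_sigma_finite_lborel)

text \<open>With \<open>s\<close> as the noise-free signal at the nodes in \<open>K\<close>, this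
  identifies the density of the observed block given everything except the noise there.\<close>

lemma distr_translate_noise_meas:
  "distr (noise_meas n K) (leb_meas n K) (translate n K s)
    = density (leb_meas n K) (\<lambda>y. ennreal (noise_dens n K (\<lambda>i k. y i k - s i k)))"
proof -
  have sym: "distr (PiM K (\<lambda>_. cn_meas)) (PiM K (\<lambda>_. lborel)) (\<lambda>z. \<lambda>k\<in>K. z k + s i k)
      = density (PiM K (\<lambda>_. lborel)) (\<lambda>y. \<Prod>k\<in>K. ennreal (gden 1 (y k - s i k)))" for i
    by (rule distr_PiM_density[where T="\<lambda>k z. z + s i k" and f="\<lambda>k y. ennreal (gden 1 (y - s i k))"])
      (auto simp: cn_meas_translate prob_space_cn_meas lborel.sigma_finite_measure_axioms measurable_cong_sets[OF sets_cn_meas refl])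
  have m: "(\<lambda>z. \<lambda>k\<in>K. z k + s i k) \<in> measurable (PiM K (\<lambda>_. cn_meas)) (PiM K (\<lambda>_. lborel))" for i
    by (intro measurable_restrict) measurable
  have "distr (noise_meas n K) (leb_meas n K) (\<lambda>z. \<lambda>i\<in>{..<n}. (\<lambda>z. \<lambda>k\<in>K. z k + s i k) (z i))
    = density (leb_meas n K) (\<lambda>y. \<Prod>i<n. (\<lambda>y. \<Prod>k\<in>K. ennreal (gden 1 (y k - s i k))) (y i))"
    unfolding noise_meas_def leb_meas_def
    by (rule distr_PiM_density[where T="\<lambda>i z. \<lambda>k\<in>K. z k + s i k"])
      (auto simp: sym m prob_space_PiM_cn intro!: sigma_finite_PiM_lborel borel_measurable_prod_ennreal)
  moreover have "(\<Prod>i<n. \<Prod>k\<in>K. ennreal (gden 1 (y i k - s i k)))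
      = ennreal (noise_dens n K (\<lambda>i k. y i k - s i k))" for y
    by (simp add: noise_dens_def prod_ennreal gden_pos less_imp_le prod_nonneg)
  ultimately show ?thesis
    by (simp add: translate_def [abs_def])
qed

lemma resample_symbol_measurable:
  "case_prod (resample_symbol K) \<in> measurable (sym_meas \<Otimes>\<^sub>M PiM K (\<lambda>_. cn_meas)) sym_meas"
  unfolding sym_meas_def resample_symbol_def [abs_def] split_beta'
proof (intro measurable_Pair measurable_abs_UNIV)
  fix k
  show "(\<lambda>p. if k \<in> K then snd p k else snd (fst p) k) \<in>
    (Pi\<^sub>M UNIV (\<lambda>_. phase_meas) \<Otimes>\<^sub>M Pi\<^sub>M UNIV (\<lambda>_. cn_meas)) \<Otimes>\<^sub>M Pi\<^sub>M K (\<lambda>_. cn_meas) \<rightarrow>\<^sub>M cn_meas"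
    by (cases "k \<in> K") simp_all
qed simp

text \<open>The preimage of a box under the replacement is a rectangle: the old coordinates are
  constrained outside \<open>K\<close> only, the fresh ones inside \<open>K\<close> only, so every
  factor occurs once.\<close>

lemma nn_integral_resample_nodes:
  assumes [measurable]: "f \<in> borel_measurable (PiM UNIV (\<lambda>_::node. cn_meas))"
  shows "(\<integral>\<^sup>+x. \<integral>\<^sup>+z. f (\<lambda>k. if k \<in> K then z k else x k) \<partial>PiM K (\<lambda>_. cn_meas) \<partial>PiM UNIV (\<lambda>_. cn_meas))
    = (\<integral>\<^sup>+x. f x \<partial>PiM UNIV (\<lambda>_. cn_meas))"
proof -
  let ?U = "PiM UNIV (\<lambda>_::node. cn_meas)" and ?K = "PiM K (\<lambda>_. cn_meas)"
  let ?T = "\<lambda>p k. if k \<in> K then snd p k else fst p k"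
  interpret cn_prod: product_sigma_finite "\<lambda>_::node. cn_meas" by unfold_locales
  note sf = prob_space_imp_sigma_finite[OF prob_space_PiM_cn]
  have T [measurable]: "?T \<in> measurable (?U \<Otimes>\<^sub>M ?K) ?U"
  proof (rule measurable_abs_UNIV)
    fix k show "(\<lambda>p. ?T p k) \<in> measurable (?U \<Otimes>\<^sub>M ?K) cn_meas"
      by (cases "k \<in> K") simp_all
  qed
  have "distr (?U \<Otimes>\<^sub>M ?K) ?U ?T = ?U"
  proof (rule cn_prod.PiM_eqI)
    fix A :: "node \<Rightarrow> complex set" assume A: "\<And>k. k \<in> UNIV \<Longrightarrow> A k \<in> sets cn_meas"
    have "emeasure (distr (?U \<Otimes>\<^sub>M ?K) ?U ?T) (Pi\<^sub>E UNIV A)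
        = emeasure (?U \<Otimes>\<^sub>M ?K) (?T -` Pi\<^sub>E UNIV A \<inter> space (?U \<Otimes>\<^sub>M ?K))"
      using A by (intro emeasure_distr T sets_PiM_I_finite) auto
    also have "?T -` Pi\<^sub>E UNIV A \<inter> space (?U \<Otimes>\<^sub>M ?K)
        = Pi\<^sub>E UNIV (\<lambda>k. if k \<in> K then UNIV else A k) \<times> Pi\<^sub>E K A"
      by (auto simp: space_pair_measure space_PiM PiE_iff split: if_splits)
    also have "emeasure (?U \<Otimes>\<^sub>M ?K) \<dots>
        = emeasure ?U (Pi\<^sub>E UNIV (\<lambda>k. if k \<in> K then UNIV else A k)) * emeasure ?K (Pi\<^sub>E K A)"
      using A by (intro sigma_finite_measure.emeasure_pair_measure_Times[OF sf] sets_PiM_I_finite) auto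
    also have "\<dots> = (\<Prod>k\<in>UNIV. emeasure cn_meas (if k \<in> K then UNIV else A k)) * (\<Prod>k\<in>K. emeasure cn_meas (A k))"
      using A by (intro arg_cong2[where f="(*)"] cn_prod.emeasure_PiM) auto
    also have "(\<Prod>k\<in>UNIV. emeasure cn_meas (if k \<in> K then UNIV else A k)) = (\<Prod>k\<in>- K. emeasure cn_meas (A k))"
      using cn.emeasure_space_1 by (intro prod.mono_neutral_cong_right) auto
    also have "\<dots> * (\<Prod>k\<in>K. emeasure cn_meas (A k)) = (\<Prod>k\<in>UNIV. emeasure cn_meas (A k))"
      by (subst prod.union_disjoint[symmetric]) (auto intro!: prod.cong)
    finally show "emeasure (distr (?U \<Otimes>\<^sub>M ?K) ?U ?T) (Pi\<^sub>E UNIV A) = (\<Prod>k\<in>UNIV. emeasure cn_meas (A k))" .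
  qed simp_all
  then have "(\<integral>\<^sup>+x. f x \<partial>?U) = (\<integral>\<^sup>+x. f x \<partial>distr (?U \<Otimes>\<^sub>M ?K) ?U ?T)" by simp
  also have "\<dots> = (\<integral>\<^sup>+p. f (?T p) \<partial>(?U \<Otimes>\<^sub>M ?K))"
    by (rule nn_integral_distr) auto
  also have "\<dots> = (\<integral>\<^sup>+x. \<integral>\<^sup>+z. f (?T (x, z)) \<partial>?K \<partial>?U)"
    by (intro sigma_finite_measure.nn_integral_fst[OF sf, symmetric]) measurable
  finally show ?thesis by (simp only: fst_conv snd_conv)
qed

lemma nn_integral_resample:
  assumes "f \<in> borel_measurable (block_meas n)"
  shows "(\<integral>\<^sup>+\<omega>. f \<omega> \<partial>block_meas n) = (\<integral>\<^sup>+\<omega>. \<integral>\<^sup>+z. f (resample n K \<omega> z) \<partial>noise_meas n K \<partial>block_meas n)"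
  unfolding block_meas_def noise_meas_def resample_def
proof (rule nn_integral_PiM_resample)
  show "f \<in> borel_measurable (PiM {..<n} (\<lambda>_. sym_meas))"
    using assms by (simp add: block_meas_def)
  let ?P = "PiM UNIV (\<lambda>_::link. phase_meas)" and ?U = "PiM UNIV (\<lambda>_::node. cn_meas)" and ?K = "PiM K (\<lambda>_. cn_meas)"
  note sf = prob_space_imp_sigma_finite[OF prob_space_PiM_cn]
  fix g :: "_ \<Rightarrow> ennreal" assume g: "g \<in> borel_measurable sym_meas"
  have gp: "(\<lambda>x. g (p, x)) \<in> borel_measurable ?U" if "p \<in> space ?P" for p
    using measurable_compose[OF measurable_Pair1'[OF that] g[unfolded sym_meas_def]] .
  have "(\<lambda>x. \<integral>\<^sup>+z. g (resample_symbol K x z) \<partial>?K) \<in> borel_measurable sym_meas"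
    using measurable_compose[OF resample_symbol_measurable g]
    by (intro sigma_finite_measure.borel_measurable_nn_integral[OF sf]) (simp add: split_beta')
  then have "(\<integral>\<^sup>+x. \<integral>\<^sup>+z. g (resample_symbol K x z) \<partial>?K \<partial>sym_meas)
      = (\<integral>\<^sup>+p. \<integral>\<^sup>+x. \<integral>\<^sup>+z. g (resample_symbol K (p, x) z) \<partial>?K \<partial>?U \<partial>?P)"
    unfolding sym_meas_def by (rule sigma_finite_measure.nn_integral_fst[OF sf, symmetric])
  also have "\<dots> = (\<integral>\<^sup>+p. \<integral>\<^sup>+x. g (p, x) \<partial>?U \<partial>?P)"
    unfolding resample_symbol_def fst_conv snd_conv
    by (intro nn_integral_cong nn_integral_resample_nodes gp)
  also have "\<dots> = (\<integral>\<^sup>+x. g x \<partial>sym_meas)"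
    using g unfolding sym_meas_def by (rule sigma_finite_measure.nn_integral_fst[OF sf])
  finally show "(\<integral>\<^sup>+x. \<integral>\<^sup>+z. g (resample_symbol K x z) \<partial>?K \<partial>sym_meas) = (\<integral>\<^sup>+x. g x \<partial>sym_meas)" .
qed (auto intro: prob_space_sym_meas prob_space_PiM_cn resample_symbol_measurable)

lemma resample_measurable:
  assumes "\<omega> \<in> space (block_meas n)"
  shows "resample n K \<omega> \<in> measurable (noise_meas n K) (block_meas n)"
  unfolding resample_def [abs_def] block_meas_def noise_meas_def
proof (rule measurable_restrict)
  fix i assume i: "i \<in> {..<n}"
  then have "\<omega> i \<in> space sym_meas"
    using assms by (auto simp: block_meas_def space_PiM)
  from measurable_compose[OF measurable_Pair1'[OF this] resample_symbol_measurable]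
  have "resample_symbol K (\<omega> i) \<in> measurable (PiM K (\<lambda>_. cn_meas)) sym_meas" by simp
  then show "(\<lambda>z. resample_symbol K (\<omega> i) (z i)) \<in> measurable (PiM {..<n} (\<lambda>_. PiM K (\<lambda>_. cn_meas))) sym_meas"
    using i by (intro measurable_compose[OF measurable_component_singleton[OF i]])
qed

section \<open>The change-of-measure inequality for labelled messages\<close>

text \<open>In the coordinates of the observation \<open>y\<close>, message \<open>m\<close>
  contributes its density times \<open>q / P m\<close>. At a given \<open>y\<close> only the
  messages with label \<open>D y\<close> survive; they share one denominator, and their densities
  add up to exactly that denominator, leaving at most \<open>q y\<close>.\<close>

lemma sum_decoded_likelihood_ratio_le:
  fixes A :: "'m set" and \<l> :: "'m \<Rightarrow> nat"
  assumes A: "finite A" and q [measurable]: "q \<in> borel_measurable (leb_meas n K)" and q0: "\<And>y. 0 \<le> q y"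
    and D: "\<And>m. m \<in> A \<Longrightarrow> {z \<in> space (noise_meas n K). D (translate n K (s m) z) = \<l> m} \<in> sets (noise_meas n K)"
  shows "(\<Sum>m\<in>A. \<integral>\<^sup>+z. ennreal (of_bool (D (translate n K (s m) z) = \<l> m) * (q (translate n K (s m) z)
      / (\<Sum>m' | m' \<in> A \<and> \<l> m' = \<l> m. noise_dens n K (\<lambda>i k. translate n K (s m) z i k - s m' i k))))
      \<partial>noise_meas n K) \<le> (\<integral>\<^sup>+y. ennreal (q y) \<partial>leb_meas n K)"
proof -
  define d where "d m y = noise_dens n K (\<lambda>i k. y i k - s m i k)" for m y
  define P where "P m y = (\<Sum>m' | m' \<in> A \<and> \<l> m' = \<l> m. d m' y)" for m y
  have [measurable]: "d m \<in> borel_measurable (leb_meas n K)" for m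
    unfolding d_def by measurable
  have [measurable]: "P m \<in> borel_measurable (leb_meas n K)" for m
    unfolding P_def by measurable
  have d0: "d m y > 0" for m y by (simp add: d_def noise_dens_pos)
  \<comment> \<open>A code promises measurability of its decisions as functions of the sample, not
    of the decoder as a function of \<open>y\<close>. Translating back by \<open>- s m\<close> moves
    the decoding region from noise space to observation space.\<close>
  have DB [measurable]: "{y \<in> space (leb_meas n K). D y = \<l> m} \<in> sets (leb_meas n K)" if m: "m \<in> A" for m
  proof -
    have "translate n K (\<lambda>i k. - s m i k) -` {z \<in> space (noise_meas n K). D (translate n K (s m) z) = \<l> m} \<inter> space (leb_meas n K)
        \<in> sets (leb_meas n K)"
      using D[OF m] by (intro measurable_sets[OF translate_measurable]) simp
    moreover have "translate n K (s m) (translate n K (\<lambda>i k. - s m i k) y) = y" if "y \<in> space (leb_meas n K)" for y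
      using that by (auto simp: translate_def space_leb_meas fun_eq_iff PiE_iff extensional_def restrict_def)
    then have "translate n K (\<lambda>i k. - s m i k) -` {z \<in> space (noise_meas n K). D (translate n K (s m) z) = \<l> m} \<inter> space (leb_meas n K)
        = {y \<in> space (leb_meas n K). D y = \<l> m}"
      using measurable_space[OF translate_measurable, of _ n K] by auto
    ultimately show ?thesis by simp
  qed
  have meas [measurable]: "(\<lambda>y. of_bool (D y = \<l> m) * (q y / P m y)) \<in> borel_measurable (leb_meas n K)" if "m \<in> A" for m
  proof -
    have [measurable]: "Measurable.pred (leb_meas n K) (\<lambda>y. D y = \<l> m)"
      using DB[OF that] by (simp add: pred_def)
    show ?thesis by measurable
  qed
  have "(\<Sum>m\<in>A. \<integral>\<^sup>+z. ennreal (of_bool (D (translate n K (s m) z) = \<l> m) * (q (translate n K (s m) z) / P m (translate n K (s m) z)))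
        \<partial>noise_meas n K)
      = (\<Sum>m\<in>A. \<integral>\<^sup>+y. ennreal (of_bool (D y = \<l> m) * (q y / P m y)) \<partial>distr (noise_meas n K) (leb_meas n K) (translate n K (s m)))"
    by (intro sum.cong refl nn_integral_distr[symmetric]) auto
  also have "\<dots> = (\<Sum>m\<in>A. \<integral>\<^sup>+y. ennreal (d m y) * ennreal (of_bool (D y = \<l> m) * (q y / P m y)) \<partial>leb_meas n K)"
    unfolding distr_translate_noise_meas d_def[symmetric] by (intro sum.cong refl nn_integral_density) auto
  also have "\<dots> = (\<integral>\<^sup>+y. (\<Sum>m\<in>A. ennreal (d m y) * ennreal (of_bool (D y = \<l> m) * (q y / P m y))) \<partial>leb_meas n K)"
    by (intro nn_integral_sum[symmetric]) auto
  also have "\<dots> \<le> (\<integral>\<^sup>+y. ennreal (q y) \<partial>leb_meas n K)"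
  proof (intro nn_integral_mono)
    fix y
    let ?B = "{m \<in> A. \<l> m = D y}"
    have nn: "0 \<le> d m y * (of_bool (D y = \<l> m) * (q y / P m y))" for m
      using d0 q0 by (simp add: P_def sum_nonneg less_imp_le)
    have "(\<Sum>m\<in>A. d m y * (of_bool (D y = \<l> m) * (q y / P m y))) = (\<Sum>m\<in>?B. d m y * (q y / (\<Sum>m\<in>?B. d m y)))"
      using A by (intro sum.mono_neutral_cong_right) (auto simp: P_def intro!: sum.cong arg_cong2[where f=sum])
    also have "\<dots> = (\<Sum>m\<in>?B. d m y) * (q y / (\<Sum>m\<in>?B. d m y))"
      by (rule sum_distrib_right[symmetric])
    \<comment> \<open>Equality if some message carries the label \<open>D y\<close>; otherwise the
      sums are empty and the left side is 0.\<close>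
    also have "\<dots> \<le> q y"
      using q0[of y] by simp
    finally have "(\<Sum>m\<in>A. d m y * (of_bool (D y = \<l> m) * (q y / P m y))) \<le> q y" .
    then show "(\<Sum>m\<in>A. ennreal (d m y) * ennreal (of_bool (D y = \<l> m) * (q y / P m y))) \<le> ennreal (q y)"
      using nn d0 by (subst ennreal_mult'[symmetric]) (auto simp: less_imp_le sum_ennreal intro: ennreal_leI)
  qed
  finally show ?thesis by (simp add: P_def d_def)
qed

text \<open>The preceding inequality is applied for each fixed \<omega> and then averaged. Since
  \<open>D\<close>, \<open>q\<close> and \<open>s\<close> may depend on all of \<omega>, whatever is
  not resampled counts as known to the receiver; but neither \<open>D\<close> nor \<open>q\<close>
  may depend on the message. \<open>est_eq\<close> and \<open>r_eq\<close> require that, once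
  \<omega> is fixed, the fresh noise acts only through the observed block.\<close>

lemma change_of_measure:
  fixes A :: "'m set" and \<l> :: "'m \<Rightarrow> nat"
  assumes A: "finite A"
    and est: "\<And>m. m \<in> A \<Longrightarrow> est m \<in> measurable (block_meas n) (count_space UNIV)"
    and r: "\<And>m. m \<in> A \<Longrightarrow> r m \<in> borel_measurable (block_meas n)"
    and q: "\<And>\<omega>. q \<omega> \<in> borel_measurable (leb_meas n K)" "\<And>\<omega> y. 0 \<le> q \<omega> y"
      "\<And>\<omega>. (\<integral>\<^sup>+y. ennreal (q \<omega> y) \<partial>leb_meas n K) \<le> 1"
    and est_eq: "\<And>\<omega> m z. m \<in> A \<Longrightarrow> est m (resample n K \<omega> z) = D \<omega> (translate n K (s \<omega> m) z)"
    and r_eq: "\<And>\<omega> m z. m \<in> A \<Longrightarrow> r m (resample n K \<omega> z) = q \<omega> (translate n K (s \<omega> m) z)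
      / (\<Sum>m' | m' \<in> A \<and> \<l> m' = \<l> m. noise_dens n K (\<lambda>i k. translate n K (s \<omega> m) z i k - s \<omega> m' i k))"
  shows "(\<Sum>m\<in>A. \<integral>\<^sup>+\<omega>. ennreal (of_bool (est m \<omega> = \<l> m) * r m \<omega>) \<partial>block_meas n) \<le> 1"
proof -
  interpret prob_space "block_meas n" by (rule prob_space_block_meas)
  interpret N: prob_space "noise_meas n K"
    unfolding noise_meas_def by (intro prob_space_PiM prob_space_cn_meas)
  have mF: "(\<lambda>\<omega>. ennreal (of_bool (est m \<omega> = \<l> m) * r m \<omega>)) \<in> borel_measurable (block_meas n)" if "m \<in> A" for m
    using est[OF that, measurable] r[OF that, measurable] by measurable
  have mI: "(\<lambda>\<omega>. \<integral>\<^sup>+z. g (resample n K \<omega> z) \<partial>noise_meas n K) \<in> borel_measurable (block_meas n)"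
    if g: "g \<in> borel_measurable (block_meas n)" for g :: "_ \<Rightarrow> ennreal"
  proof (rule N.borel_measurable_nn_integral)
    have "(\<lambda>p. resample n K (fst p) (snd p)) \<in> measurable (block_meas n \<Otimes>\<^sub>M noise_meas n K) (block_meas n)"
      unfolding resample_def block_meas_def noise_meas_def
    proof (rule measurable_restrict)
      fix i assume "i \<in> {..<n}"
      then have "(\<lambda>p. (fst p i, snd p i)) \<in> measurable (PiM {..<n} (\<lambda>_. sym_meas) \<Otimes>\<^sub>M PiM {..<n} (\<lambda>_. PiM K (\<lambda>_. cn_meas)))
          (sym_meas \<Otimes>\<^sub>M PiM K (\<lambda>_. cn_meas))"
        by (intro measurable_Pair measurable_compose[OF measurable_fst] measurable_compose[OF measurable_snd]
          measurable_component_singleton)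
      from measurable_compose[OF this resample_symbol_measurable]
      show "(\<lambda>p. resample_symbol K (fst p i) (snd p i)) \<in> measurable (PiM {..<n} (\<lambda>_. sym_meas) \<Otimes>\<^sub>M PiM {..<n} (\<lambda>_. PiM K (\<lambda>_. cn_meas))) sym_meas"
        by simp
    qed
    from measurable_compose[OF this g]
    show "(\<lambda>(\<omega>, z). g (resample n K \<omega> z)) \<in> borel_measurable (block_meas n \<Otimes>\<^sub>M noise_meas n K)"
      by (simp add: split_beta')
  qed
  have "(\<Sum>m\<in>A. \<integral>\<^sup>+\<omega>. ennreal (of_bool (est m \<omega> = \<l> m) * r m \<omega>) \<partial>block_meas n)
     = (\<Sum>m\<in>A. \<integral>\<^sup>+\<omega>. \<integral>\<^sup>+z. ennreal (of_bool (est m (resample n K \<omega> z) = \<l> m) * r m (resample n K \<omega> z)) \<partial>noise_meas n K \<partial>block_meas n)"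
    using mF by (intro sum.cong refl nn_integral_resample)
  also have "\<dots> = (\<integral>\<^sup>+\<omega>. (\<Sum>m\<in>A. \<integral>\<^sup>+z. ennreal (of_bool (est m (resample n K \<omega> z) = \<l> m) * r m (resample n K \<omega> z)) \<partial>noise_meas n K) \<partial>block_meas n)"
    using mI[OF mF] by (intro nn_integral_sum[symmetric])
  also have "\<dots> \<le> (\<integral>\<^sup>+\<omega>. 1 \<partial>block_meas n)"
  proof (intro nn_integral_mono)
    fix \<omega> assume \<omega>: "\<omega> \<in> space (block_meas n)"
    have "(\<Sum>m\<in>A. \<integral>\<^sup>+z. ennreal (of_bool (est m (resample n K \<omega> z) = \<l> m) * r m (resample n K \<omega> z)) \<partial>noise_meas n K)
      \<le> (\<integral>\<^sup>+y. ennreal (q \<omega> y) \<partial>leb_meas n K)"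
    proof -
      have "{z \<in> space (noise_meas n K). D \<omega> (translate n K (s \<omega> m) z) = \<l> m} \<in> sets (noise_meas n K)" if "m \<in> A" for m
      proof -
        have "(\<lambda>z. est m (resample n K \<omega> z)) \<in> measurable (noise_meas n K) (count_space UNIV)"
          by (rule measurable_compose[OF resample_measurable[OF \<omega>] est[OF that]])
        then have "(\<lambda>z. est m (resample n K \<omega> z)) -` {\<l> m} \<inter> space (noise_meas n K) \<in> sets (noise_meas n K)"
          by (rule measurable_sets) simp
        then show ?thesis
          by (rule back_subst[of "\<lambda>X. X \<in> _"]) (auto simp: est_eq[OF that])
      qed
      from sum_decoded_likelihood_ratio_le[OF A q(1,2) this]
      show ?thesis by (simp add: est_eq r_eq cong: sum.cong)
    qed
    also have "\<dots> \<le> 1" by (rule q(3))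
    finally show "(\<Sum>m\<in>A. \<integral>\<^sup>+z. ennreal (of_bool (est m (resample n K \<omega> z) = \<l> m) * r m (resample n K \<omega> z)) \<partial>noise_meas n K) \<le> 1" .
  qed
  also have "\<dots> = 1" by (simp add: emeasure_space_1)
  finally show ?thesis .
qed

section \<open>Gaussian test densities and their mixtures\<close>

lemma nn_integral_leb_meas_prod:
  assumes "\<And>i. f i \<in> borel_measurable (PiM K (\<lambda>_. lborel))"
  shows "(\<integral>\<^sup>+y. (\<Prod>i<n. f i (y i)) \<partial>leb_meas n K) = (\<Prod>i<n. \<integral>\<^sup>+x. f i x \<partial>PiM K (\<lambda>_. lborel))"
proof -
  interpret product_sigma_finite "\<lambda>_::nat. PiM K (\<lambda>_. lborel)"
    by (simp add: product_sigma_finite_def sigma_finite_PiM_lborel)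
  show ?thesis
    unfolding leb_meas_def using assms by (intro product_nn_integral_prod) auto
qed

lemma nn_integral_gaussian_block:
  assumes "v > 0"
  shows "(\<integral>\<^sup>+y. ennreal (\<Prod>i<n. gden v (y i k - \<mu> i)) \<partial>leb_meas n {k}) = 1"
proof -
  interpret L: product_sigma_finite "\<lambda>_::node. lborel :: complex measure" by (rule product_sigma_finite_lborel)
  have "(\<integral>\<^sup>+y. ennreal (\<Prod>i<n. gden v (y i k - \<mu> i)) \<partial>leb_meas n {k})
     = (\<integral>\<^sup>+y. (\<Prod>i<n. ennreal (gden v (y i k - \<mu> i))) \<partial>leb_meas n {k})"
    using assms by (simp add: prod_ennreal gden_pos less_imp_le)
  also have "\<dots> = (\<Prod>i<n. \<integral>\<^sup>+x. ennreal (gden v (x k - \<mu> i)) \<partial>PiM {k} (\<lambda>_. lborel))"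
    by (rule nn_integral_leb_meas_prod) measurable
  also have "\<dots> = (\<Prod>i<n. \<integral>\<^sup>+x. ennreal (gden v (x - \<mu> i)) \<partial>lborel)"
    by (intro prod.cong refl L.product_nn_integral_singleton[where f="\<lambda>x. ennreal (gden v (x - _ ))"]) simp
  also have "\<dots> = 1"
    using assms by (simp add: nn_integral_gden_translate)
  finally show ?thesis .
qed

text \<open>Integrating the coordinate \<open>k'\<close> first, with \<open>k\<close> held fixed,
  gives 1 whatever its centre \<open>t i * y i k\<close>; the integral over \<open>k\<close> is then
  Gaussian. In other words, a shear of the plane preserves volume.\<close>

lemma nn_integral_gaussian_pair_block:
  assumes v: "v > 0" and w: "w > 0" and k: "k \<noteq> k'"
  shows "(\<integral>\<^sup>+y. ennreal (\<Prod>i<n. gden v (y i k - \<mu> i) * gden w (y i k' - t i * y i k)) \<partial>leb_meas n {k, k'}) = 1"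
proof -
  interpret L: product_sigma_finite "\<lambda>_::node. lborel :: complex measure" by (rule product_sigma_finite_lborel)
  have one: "(\<integral>\<^sup>+x. ennreal (gden v (x k - a)) * ennreal (gden w (x k' - b * x k)) \<partial>PiM {k, k'} (\<lambda>_. lborel)) = 1" for a b
  proof -
    have "(\<integral>\<^sup>+x. ennreal (gden v (x k - a)) * ennreal (gden w (x k' - b * x k)) \<partial>PiM {k', k} (\<lambda>_. lborel))
       = (\<integral>\<^sup>+x. \<integral>\<^sup>+y. ennreal (gden v (x k - a)) * ennreal (gden w (y - b * x k)) \<partial>lborel \<partial>PiM {k} (\<lambda>_. lborel))"
      using k by (subst L.product_nn_integral_insert) auto
    also have "\<dots> = (\<integral>\<^sup>+x. ennreal (gden v (x k - a)) \<partial>PiM {k} (\<lambda>_. lborel))"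
      using w by (subst nn_integral_cmult) (auto simp: nn_integral_gden_translate)
    also have "\<dots> = (\<integral>\<^sup>+x. ennreal (gden v (x - a)) \<partial>lborel)"
      by (rule L.product_nn_integral_singleton[where f="\<lambda>x. ennreal (gden v (x - a))"]) simp
    also have "\<dots> = 1" using v by (rule nn_integral_gden_translate)
    finally show ?thesis by (simp add: insert_commute)
  qed
  have "(\<integral>\<^sup>+y. ennreal (\<Prod>i<n. gden v (y i k - \<mu> i) * gden w (y i k' - t i * y i k)) \<partial>leb_meas n {k, k'})
     = (\<integral>\<^sup>+y. (\<Prod>i<n. ennreal (gden v (y i k - \<mu> i)) * ennreal (gden w (y i k' - t i * y i k))) \<partial>leb_meas n {k, k'})"
    using v w by (simp add: prod_ennreal gden_pos less_imp_le ennreal_mult' flip: ennreal_mult')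
  also have "\<dots> = (\<Prod>i<n. \<integral>\<^sup>+x. ennreal (gden v (x k - \<mu> i)) * ennreal (gden w (x k' - t i * x k)) \<partial>PiM {k, k'} (\<lambda>_. lborel))"
    by (rule nn_integral_leb_meas_prod[where f="\<lambda>i x. ennreal (gden v (x k - \<mu> i)) * ennreal (gden w (x k' - t i * x k))"]) measurable
  also have "\<dots> = 1" by (simp add: one)
  finally show ?thesis .
qed

lemma nn_integral_average:
  assumes A: "finite A" "A \<noteq> {}" and f: "\<And>m. m \<in> A \<Longrightarrow> f m \<in> borel_measurable M" "\<And>m y. m \<in> A \<Longrightarrow> 0 \<le> f m y"
    and one: "\<And>m. m \<in> A \<Longrightarrow> (\<integral>\<^sup>+y. ennreal (f m y) \<partial>M) = 1"
  shows "(\<integral>\<^sup>+y. ennreal ((\<Sum>m\<in>A. f m y) / real (card A)) \<partial>M) = 1"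
proof -
  have c: "card A > 0" using A by (simp add: card_gt_0_iff)
  have "(\<integral>\<^sup>+y. ennreal ((\<Sum>m\<in>A. f m y) / real (card A)) \<partial>M) = (\<integral>\<^sup>+y. (\<Sum>m\<in>A. ennreal (f m y)) / of_nat (card A) \<partial>M)"
    using f c by (intro nn_integral_cong) (simp add: sum_ennreal sum_nonneg ennreal_of_nat_eq_real_of_nat divide_ennreal)
  also have "\<dots> = (\<Sum>m\<in>A. \<integral>\<^sup>+y. ennreal (f m y) \<partial>M) / of_nat (card A)"
    using f by (subst nn_integral_divide) (auto simp del: sum_ennreal simp: nn_integral_sum)
  also have "\<dots> = 1"
    using c by (simp add: one ennreal_of_nat_eq_real_of_nat divide_ennreal)
  finally show ?thesis .
qed

section \<open>Energy of a block\<close>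

lemma cmod_add_sq_le: "(cmod (x + y))\<^sup>2 \<le> 2 * (cmod x)\<^sup>2 + 2 * (cmod y)\<^sup>2"
proof -
  have "(cmod (x + y))\<^sup>2 \<le> (cmod x + cmod y)\<^sup>2"
    by (intro power_mono norm_triangle_ineq) simp
  also have "\<dots> \<le> 2 * (cmod x)\<^sup>2 + 2 * (cmod y)\<^sup>2"
    using zero_le_power2[of "cmod x - cmod y"] by (simp add: power2_eq_square algebra_simps)
  finally show ?thesis .
qed

text \<open>Under the hypothesis the exponent at \<open>u\<close> exceeds that at \<open>w\<close>
  by at most \<open>C * e i\<close>. Besides this energy cost only the ratio of the normalizing
  constants, \<open>1 / v\<close> per symbol, is lost. All rate exponents of the proof originate in
  this factor.\<close>

lemma prod_gden_ge:
  assumes v: "v > 0" and le: "\<And>i. i < n \<Longrightarrow> (cmod (u i))\<^sup>2 \<le> v * ((cmod (w i))\<^sup>2 + C * e i)"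
  shows "(1 / v) ^ n * exp (- (C * (\<Sum>i<n. e i))) * (\<Prod>i<n. gden 1 (w i)) \<le> (\<Prod>i<n. gden v (u i))"
proof -
  have "(1 / v) ^ n * exp (- (C * (\<Sum>i<n. e i))) * (\<Prod>i<n. gden 1 (w i))
      = (\<Prod>i<n. 1 / v * exp (- (C * e i)) * gden 1 (w i))"
    unfolding prod.distrib by (simp add: sum_distrib_left exp_sum flip: sum_negf)
  also have "\<dots> \<le> (\<Prod>i<n. gden v (u i))"
  proof (intro prod_mono conjI)
    fix i assume i: "i \<in> {..<n}"
    show "0 \<le> 1 / v * exp (- (C * e i)) * gden 1 (w i)"
      using v by (simp add: gden_pos less_imp_le)
    have "- (C * e i) - (cmod (w i))\<^sup>2 \<le> - (cmod (u i))\<^sup>2 / v"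
      using le[of i] i v by (simp add: field_simps)
    then have "exp (- (C * e i)) * exp (- (cmod (w i))\<^sup>2) \<le> exp (- (cmod (u i))\<^sup>2 / v)"
      by (simp flip: exp_add)
    then show "1 / v * exp (- (C * e i)) * gden 1 (w i) \<le> gden v (u i)"
      using v by (simp add: gden_def field_simps)
  qed
  finally show ?thesis .
qed

section \<open>Channel outputs under resampling\<close>

lemma trunc_cong: "(\<And>i. i < n \<Longrightarrow> f i = g i) \<Longrightarrow> trunc n f = trunc n g"
  by (auto simp: trunc_def)

lemma gain_resample: "i < n \<Longrightarrow> gain snr l (resample n K \<omega> z) i = gain snr l \<omega> i"
  by (simp add: gain_def resample_def resample_symbol_def)

lemma noise_resample:
  "i < n \<Longrightarrow> noise k (resample n K \<omega> z) i = (if k \<in> K then z i k else noise k \<omega> i)"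
  by (simp add: noise_def resample_def resample_symbol_def)

text \<open>As long as the relay's noise is kept, its past input is unchanged, so for fixed \<omega>
  the relay signal is a deterministic codeword indexed by \<open>m\<close>.\<close>

lemma relay_out_resample:
  "i < n \<Longrightarrow> N3 \<notin> K \<Longrightarrow> relay_out c snr m (resample n K \<omega> z) i = relay_out c snr m \<omega> i"
  unfolding relay_out_def relay_in_def
  by (intro arg_cong2[where f="relayf c i"] trunc_cong) (auto simp: gain_resample noise_resample)

lemma translate_apply: "i < n \<Longrightarrow> k \<in> K \<Longrightarrow> translate n K s z i k = z i k + s i k"
  by (simp add: translate_def)

lemma est1_resample:
  assumes "\<And>i. i < n \<Longrightarrow> out1 c snr m1 m2 (resample n K \<omega> z) i = y i"
  shows "est1 c snr n m1 m2 (resample n K \<omega> z)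
    = dec1 c (trunc n y) (trunc n (gain snr L11 \<omega>)) (trunc n (gain snr L21 \<omega>)) (trunc n (gain snr L31 \<omega>))"
proof -
  have "trunc n (out1 c snr m1 m2 (resample n K \<omega> z)) = trunc n y"
    and "trunc n (gain snr l (resample n K \<omega> z)) = trunc n (gain snr l \<omega>)" for l
    by (auto intro!: trunc_cong simp: assms gain_resample)
  then show ?thesis by (simp add: est1_def)
qed

lemma est2_resample:
  assumes "\<And>i. i < n \<Longrightarrow> out2 c snr m1 m2 (resample n K \<omega> z) i = y i"
  shows "est2 c snr n m1 m2 (resample n K \<omega> z)
    = dec2 c (trunc n y) (trunc n (gain snr L22 \<omega>)) (trunc n (gain snr L32 \<omega>))"
proof -
  have "trunc n (out2 c snr m1 m2 (resample n K \<omega> z)) = trunc n y"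
    and "trunc n (gain snr l (resample n K \<omega> z)) = trunc n (gain snr l \<omega>)" for l
    by (auto intro!: trunc_cong simp: assms gain_resample)
  then show ?thesis by (simp add: est2_def)
qed

lemma cmod_gain_mult_sq: "snr l \<ge> 0 \<Longrightarrow> (cmod (gain snr l \<omega> i * x))\<^sup>2 = snr l * (cmod x)\<^sup>2"
  by (simp add: gain_def norm_mult power_mult_distrib)

lemma component_measurable:
  "i < n \<Longrightarrow> (\<lambda>\<omega>. \<omega> i) \<in> measurable (block_meas n) sym_meas"
  unfolding block_meas_def by measurable

lemma gain_measurable [measurable]:
  assumes "i < n" shows "(\<lambda>\<omega>. gain snr l \<omega> i) \<in> borel_measurable (block_meas n)"
proof -
  have "(\<lambda>x. fst x l) \<in> borel_measurable sym_meas"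
    unfolding sym_meas_def by measurable
  from measurable_compose[OF component_measurable[OF assms] this]
  have [measurable]: "(\<lambda>\<omega>. fst (\<omega> i) l) \<in> borel_measurable (block_meas n)" .
  show ?thesis unfolding gain_def cis_conv_exp by measurable
qed

lemma snd_component_measurable: "(\<lambda>x. snd x k) \<in> borel_measurable sym_meas"
  unfolding sym_meas_def by measurable

lemma noise_measurable [measurable]:
  assumes "i < n" shows "(\<lambda>\<omega>. noise k \<omega> i) \<in> borel_measurable (block_meas n)"
  unfolding noise_def
  using measurable_compose[OF component_measurable[OF assms] snd_component_measurable] .

lemma noise_second_moment:
  assumes i: "i < n"
  shows "(\<integral>\<^sup>+\<omega>. ennreal ((cmod (noise k \<omega> i))\<^sup>2) \<partial>block_meas n) \<le> 4"
proof -
  let ?P = "PiM UNIV (\<lambda>_::link. phase_meas)" and ?U = "PiM UNIV (\<lambda>_::node. cn_meas)"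
  interpret S: product_prob_space "\<lambda>_::nat. sym_meas" "{..<n}"
    using prob_space_sym_meas
    by (simp add: product_prob_space_def product_sigma_finite_def product_prob_space_axioms_def prob_space_imp_sigma_finite)
  interpret U: product_prob_space "\<lambda>_::node. cn_meas" UNIV
    using prob_space_cn_meas
    by (simp add: product_prob_space_def product_sigma_finite_def product_prob_space_axioms_def prob_space_imp_sigma_finite)
  have m: "(\<lambda>x. ennreal ((cmod (snd x k))\<^sup>2)) \<in> borel_measurable sym_meas"
    using snd_component_measurable[of k] by measurable
  have "(\<integral>\<^sup>+\<omega>. ennreal ((cmod (noise k \<omega> i))\<^sup>2) \<partial>block_meas n)
      = (\<integral>\<^sup>+x. ennreal ((cmod (snd x k))\<^sup>2) \<partial>distr (block_meas n) sym_meas (\<lambda>\<omega>. \<omega> i))"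
    unfolding noise_def using component_measurable[OF i] m by (subst nn_integral_distr) auto
  also have "distr (block_meas n) sym_meas (\<lambda>\<omega>. \<omega> i) = sym_meas"
    unfolding block_meas_def using i S.PiM_component[of i] by simp
  also have "(\<integral>\<^sup>+x. ennreal ((cmod (snd x k))\<^sup>2) \<partial>sym_meas)
      = (\<integral>\<^sup>+p. \<integral>\<^sup>+x. ennreal ((cmod (x k))\<^sup>2) \<partial>?U \<partial>?P)"
    using sigma_finite_measure.nn_integral_fst[OF prob_space_imp_sigma_finite[OF prob_space_PiM_cn] m[unfolded sym_meas_def]]
    unfolding sym_meas_def by simp
  also have "\<dots> = (\<integral>\<^sup>+x. ennreal ((cmod (x k))\<^sup>2) \<partial>?U)"
    using prob_space.emeasure_space_1[OF prob_space_PiM_phase[of "UNIV :: link set"]] by simp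
  also have "\<dots> = (\<integral>\<^sup>+x. ennreal ((cmod x)\<^sup>2) \<partial>distr ?U cn_meas (\<lambda>x. x k))"
    by (rule nn_integral_distr[symmetric]) auto
  also have "distr ?U cn_meas (\<lambda>x. x k) = cn_meas"
    using U.PiM_component[of k] by simp
  also have "(\<integral>\<^sup>+x. ennreal ((cmod x)\<^sup>2) \<partial>cn_meas) \<le> 4"
    by (rule cn_meas_second_moment)
  finally show ?thesis .
qed

section \<open>A fixed code: energy, the good event and message counting\<close>

locale zicr_code =
  fixes snr :: "link \<Rightarrow> real" and n :: nat and c :: zcode
  assumes valid: "valid_code snr n c" and snr_ge_1: "\<And>l. 1 \<le> snr l"
begin

abbreviation "M1 \<equiv> nmsg1 c"
abbreviation "M2 \<equiv> nmsg2 c"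
abbreviation "X1 \<equiv> enc1 c"
abbreviation "X2 \<equiv> enc2 c"
abbreviation "X3 \<equiv> relay_out c snr"
abbreviation "H \<equiv> gain snr"
abbreviation "e1 m1 m2 \<equiv> est1 c snr n m1 m2"
abbreviation "e2 m1 m2 \<equiv> est2 c snr n m1 m2"

lemma M_pos: "M1 > 0" "M2 > 0"
  using valid by (auto simp: valid_code_def)

lemma snr_pos: "snr l > 0" "snr l \<ge> 0"
  using snr_ge_1[of l] by auto

lemma gain_nz: "H l \<omega> i \<noteq> 0"
  using snr_pos(1)[of l] by (simp add: gain_def)

lemma cmod_gain_sq: "(cmod (H l \<omega> i * x))\<^sup>2 = snr l * (cmod x)\<^sup>2"
  by (rule cmod_gain_mult_sq) (rule snr_pos)

lemma cmod_gain_ratio_sq: "(cmod (H l \<omega> i / H l' \<omega> i * x))\<^sup>2 = snr l / snr l' * (cmod x)\<^sup>2"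
  using snr_pos by (simp add: gain_def norm_mult norm_divide power_mult_distrib power_divide)

lemma relay_measurable [measurable]:
  "m < M1 \<Longrightarrow> i < n \<Longrightarrow> (\<lambda>\<omega>. X3 m \<omega> i) \<in> borel_measurable (block_meas n)"
  using valid by (auto simp: valid_code_def)

lemma est_measurable:
  "m1 < M1 \<Longrightarrow> m2 < M2 \<Longrightarrow> e1 m1 m2 \<in> measurable (block_meas n) (count_space UNIV)"
  "m1 < M1 \<Longrightarrow> m2 < M2 \<Longrightarrow> e2 m1 m2 \<in> measurable (block_meas n) (count_space UNIV)"
  using valid by (auto simp: valid_code_def)

text \<open>The quadratic forms in the ratio bounds involve only these six moduli, so one energy
  event controls all of them.\<close>

definition sym_energy :: "nat \<Rightarrow> nat \<Rightarrow> sample \<Rightarrow> nat \<Rightarrow> real" where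
  "sym_energy m1 m2 \<omega> i = (cmod (X1 m1 i))\<^sup>2 + (cmod (X2 m2 i))\<^sup>2 + (cmod (X3 m1 \<omega> i))\<^sup>2
     + (cmod (noise N1 \<omega> i))\<^sup>2 + (cmod (noise N2 \<omega> i))\<^sup>2 + (cmod (noise N3 \<omega> i))\<^sup>2"

definition energy :: "nat \<Rightarrow> nat \<Rightarrow> sample \<Rightarrow> real" where
  "energy m1 m2 \<omega> = (\<Sum>i<n. sym_energy m1 m2 \<omega> i)"

lemma sym_energy_measurable [measurable]:
  "m1 < M1 \<Longrightarrow> i < n \<Longrightarrow> (\<lambda>\<omega>. sym_energy m1 m2 \<omega> i) \<in> borel_measurable (block_meas n)"
  unfolding sym_energy_def by measurable

lemma energy_measurable [measurable]:
  "m1 < M1 \<Longrightarrow> energy m1 m2 \<in> borel_measurable (block_meas n)"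
  unfolding energy_def [abs_def] by (intro borel_measurable_sum) auto

text \<open>The 15 is 1 for each of the three power constraints plus 4 for each of the three noises.
  Sums over the messages replace averages, hence the factor \<open>M1 * M2\<close>.\<close>

lemma sym_energy_expectation:
  assumes i: "i < n"
  shows "(\<Sum>m1<M1. \<Sum>m2<M2. \<integral>\<^sup>+\<omega>. ennreal (sym_energy m1 m2 \<omega> i) \<partial>block_meas n) \<le> ennreal (15 * M1 * M2)"
proof -
  interpret prob_space "block_meas n" by (rule prob_space_block_meas)
  let ?a = "\<lambda>m. (cmod (X1 m i))\<^sup>2" and ?b = "\<lambda>m. (cmod (X2 m i))\<^sup>2"
  let ?r = "\<lambda>m. \<integral>\<^sup>+\<omega>. ennreal ((cmod (X3 m \<omega> i))\<^sup>2) \<partial>block_meas n"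
  let ?z = "\<lambda>k. \<integral>\<^sup>+\<omega>. ennreal ((cmod (noise k \<omega> i))\<^sup>2) \<partial>block_meas n"
  have eq: "(\<integral>\<^sup>+\<omega>. ennreal (sym_energy m1 m2 \<omega> i) \<partial>block_meas n)
      = ennreal (?a m1) + ennreal (?b m2) + ?r m1 + (?z N1 + ?z N2 + ?z N3)" if "m1 < M1" for m1 m2
    using i that by (simp add: sym_energy_def nn_integral_add emeasure_space_1 add.assoc)
  have z: "?z N1 + ?z N2 + ?z N3 \<le> ennreal 12"
  proof -
    have "?z N1 + ?z N2 + ?z N3 \<le> 4 + 4 + 4"
      using noise_second_moment[OF i] by (intro add_mono)
    then show ?thesis by simp
  qed
  have a: "(\<Sum>m<M1. ennreal (?a m)) \<le> ennreal (real M1)" and b: "(\<Sum>m<M2. ennreal (?b m)) \<le> ennreal (real M2)"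
    and r: "(\<Sum>m<M1. ?r m) \<le> ennreal (real M1)"
    using valid i by (auto simp: valid_code_def intro: ennreal_leI)
  have "(\<Sum>m1<M1. \<Sum>m2<M2. \<integral>\<^sup>+\<omega>. ennreal (sym_energy m1 m2 \<omega> i) \<partial>block_meas n)
      = (\<Sum>m1<M1. \<Sum>m2<M2. ennreal (?a m1) + ennreal (?b m2) + ?r m1 + (?z N1 + ?z N2 + ?z N3))"
    by (intro sum.cong refl) (auto simp: eq)
  also have "\<dots> = of_nat M2 * (\<Sum>m<M1. ennreal (?a m)) + of_nat M1 * (\<Sum>m<M2. ennreal (?b m))
      + of_nat M2 * (\<Sum>m<M1. ?r m) + of_nat M1 * (of_nat M2 * (?z N1 + ?z N2 + ?z N3))"
    by (simp only: sum.distrib sum_constant card_lessThan sum_distrib_left distrib_left)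
  also have "\<dots> \<le> of_nat M2 * ennreal (real M1) + of_nat M1 * ennreal (real M2)
      + of_nat M2 * ennreal (real M1) + of_nat M1 * (of_nat M2 * ennreal 12)"
    using a b r z by (intro add_mono mult_left_mono) auto
  also have "\<dots> = ennreal (15 * M1 * M2)"
    by (simp add: ennreal_of_nat_eq_real_of_nat flip: ennreal_mult' ennreal_plus ennreal_numeral)
  finally show ?thesis .
qed

lemma energy_expectation:
  "(\<Sum>m1<M1. \<Sum>m2<M2. \<integral>\<^sup>+\<omega>. ennreal (energy m1 m2 \<omega>) \<partial>block_meas n) \<le> ennreal (15 * n * M1 * M2)"
proof -
  have nn: "0 \<le> sym_energy m1 m2 \<omega> i" for m1 m2 \<omega> i by (simp add: sym_energy_def)
  have "(\<Sum>m1<M1. \<Sum>m2<M2. \<integral>\<^sup>+\<omega>. ennreal (energy m1 m2 \<omega>) \<partial>block_meas n)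
     = (\<Sum>m1<M1. \<Sum>m2<M2. \<Sum>i<n. \<integral>\<^sup>+\<omega>. ennreal (sym_energy m1 m2 \<omega> i) \<partial>block_meas n)"
    by (intro sum.cong refl, subst nn_integral_sum[symmetric]) (auto simp: energy_def nn sum_ennreal)
  also have "\<dots> = (\<Sum>i<n. \<Sum>m1<M1. \<Sum>m2<M2. \<integral>\<^sup>+\<omega>. ennreal (sym_energy m1 m2 \<omega> i) \<partial>block_meas n)"
    by (subst (2) sum.swap, subst sum.swap) simp
  also have "\<dots> \<le> (\<Sum>i<n. ennreal (15 * M1 * M2))"
    by (intro sum_mono sym_energy_expectation) simp
  also have "\<dots> = ennreal (15 * n * M1 * M2)"
    by (simp add: ennreal_of_nat_eq_real_of_nat mult_ac flip: ennreal_mult')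
  finally show ?thesis .
qed

text \<open>Both decisions are required to be correct at once because the sum-rate bound uses the
  two ratios at the same sample.\<close>

definition good :: "nat \<Rightarrow> nat \<Rightarrow> sample set" where
  "good m1 m2 = {\<omega> \<in> space (block_meas n). e1 m1 m2 \<omega> = m1 \<and> e2 m1 m2 \<omega> = m2 \<and> energy m1 m2 \<omega> \<le> 60 * n}"

lemma good_sets [measurable]: "m1 < M1 \<Longrightarrow> m2 < M2 \<Longrightarrow> good m1 m2 \<in> sets (block_meas n)"
proof -
  assume *: "m1 < M1" "m2 < M2"
  note [measurable] = est_measurable[OF *] energy_measurable[OF *(1)]
  show ?thesis unfolding good_def by measurable
qed

text \<open>The threshold \<open>60 * n\<close> is four times the mean energy bound
  \<open>15 * n\<close>, so by Markov's inequality excess energy takes at most a quarter of the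
  total mass \<open>M1 * M2\<close>; decoding errors take at most another quarter.\<close>

lemma good_mass:
  assumes n: "n > 0" and err: "err_prob snr n c \<le> 1/4"
  shows "real M1 * real M2 / 2 \<le> (\<Sum>m1<M1. \<Sum>m2<M2. measure (block_meas n) (good m1 m2))"
proof -
  interpret prob_space "block_meas n" by (rule prob_space_block_meas)
  define b where "b m1 m2 = {\<omega> \<in> space (block_meas n). energy m1 m2 \<omega> > 60 * n}" for m1 m2
  define w where "w m1 m2 = {\<omega> \<in> space (block_meas n). e1 m1 m2 \<omega> \<noteq> m1 \<or> e2 m1 m2 \<omega> \<noteq> m2}" for m1 m2
  have bs [measurable]: "b m1 m2 \<in> events" if "m1 < M1" for m1 m2
    using energy_measurable[OF that, measurable] unfolding b_def by measurable
  have ws [measurable]: "w m1 m2 \<in> events" if "m1 < M1" "m2 < M2" for m1 m2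
    using est_measurable[OF that, measurable] unfolding w_def by measurable
  have W: "(\<Sum>m1<M1. \<Sum>m2<M2. prob (w m1 m2)) \<le> real M1 * real M2 / 4"
    using err M_pos by (simp add: err_prob_def w_def field_simps)
  have bm: "ennreal (prob (b m1 m2)) \<le> ennreal (1 / (60 * n)) * (\<integral>\<^sup>+\<omega>. ennreal (energy m1 m2 \<omega>) \<partial>block_meas n)"
    if m: "m1 < M1" for m1 m2
  proof -
    note energy_measurable[OF m, measurable]
    have "emeasure (block_meas n) (b m1 m2) \<le> emeasure (block_meas n)
       ({\<omega> \<in> space (block_meas n). 1 \<le> ennreal (1 / (60 * n)) * ennreal (energy m1 m2 \<omega>)} \<inter> space (block_meas n))"
    proof (intro emeasure_mono subsetI)
      fix \<omega> assume "\<omega> \<in> b m1 m2"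
      then have "\<omega> \<in> space (block_meas n)" and "1 \<le> 1 / (60 * real n) * energy m1 m2 \<omega>"
        using n by (auto simp: b_def field_simps)
      then show "\<omega> \<in> {\<omega> \<in> space (block_meas n). 1 \<le> ennreal (1 / (60 * n)) * ennreal (energy m1 m2 \<omega>)} \<inter> space (block_meas n)"
        using n by (simp flip: ennreal_mult')
    qed measurable
    also have "\<dots> \<le> ennreal (1 / (60 * n)) * (\<integral>\<^sup>+\<omega>. ennreal (energy m1 m2 \<omega>) * indicator (space (block_meas n)) \<omega> \<partial>block_meas n)"
      by (rule order_trans[OF _ nn_integral_Markov_inequality]) (auto intro!: emeasure_mono)
    finally show ?thesis
      by (simp add: emeasure_eq_measure cong: nn_integral_cong)
  qed
  have "ennreal (\<Sum>m1<M1. \<Sum>m2<M2. prob (b m1 m2)) = (\<Sum>m1<M1. \<Sum>m2<M2. ennreal (prob (b m1 m2)))"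
    by (simp add: sum_ennreal sum_nonneg)
  also have "\<dots> \<le> (\<Sum>m1<M1. \<Sum>m2<M2. ennreal (1 / (60 * n)) * (\<integral>\<^sup>+\<omega>. ennreal (energy m1 m2 \<omega>) \<partial>block_meas n))"
    by (intro sum_mono bm) simp
  also have "\<dots> = ennreal (1 / (60 * n)) * (\<Sum>m1<M1. \<Sum>m2<M2. \<integral>\<^sup>+\<omega>. ennreal (energy m1 m2 \<omega>) \<partial>block_meas n)"
    by (simp only: sum_distrib_left)
  also have "\<dots> \<le> ennreal (1 / (60 * n)) * ennreal (15 * n * M1 * M2)"
    by (intro mult_left_mono energy_expectation) simp
  also have "\<dots> = ennreal (real M1 * real M2 / 4)"
    using n by (simp add: field_simps flip: ennreal_mult')
  finally have B: "(\<Sum>m1<M1. \<Sum>m2<M2. prob (b m1 m2)) \<le> real M1 * real M2 / 4"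
    by (subst (asm) ennreal_le_iff) auto
  have "1 - prob (w m1 m2) - prob (b m1 m2) \<le> prob (good m1 m2)" if m: "m1 < M1" "m2 < M2" for m1 m2
  proof -
    have "1 = prob (space (block_meas n))" by (simp add: prob_space)
    also have "space (block_meas n) = good m1 m2 \<union> (w m1 m2 \<union> b m1 m2)"
      by (auto simp: good_def w_def b_def)
    also have "prob \<dots> \<le> prob (good m1 m2) + (prob (w m1 m2) + prob (b m1 m2))"
      using m by (intro order_trans[OF measure_Un_le] add_mono measure_Un_le order_refl) auto
    finally show ?thesis by simp
  qed
  then have "(\<Sum>m1<M1. \<Sum>m2<M2. 1 - prob (w m1 m2) - prob (b m1 m2)) \<le> (\<Sum>m1<M1. \<Sum>m2<M2. prob (good m1 m2))"
    by (intro sum_mono) simp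
  moreover have "(\<Sum>m1<M1. \<Sum>m2<M2. 1 - prob (w m1 m2) - prob (b m1 m2))
     = real M1 * real M2 - (\<Sum>m1<M1. \<Sum>m2<M2. prob (w m1 m2)) - (\<Sum>m1<M1. \<Sum>m2<M2. prob (b m1 m2))"
    by (simp add: sum_subtractf)
  ultimately show ?thesis using W B by linarith
qed

lemma sum_good_le:
  assumes A: "finite A" and m: "\<And>x. x \<in> A \<Longrightarrow> f x < M1 \<and> g x < M2" and \<kappa>: "\<kappa> > 0"
    and b: "(\<Sum>x\<in>A. \<integral>\<^sup>+\<omega>. F x \<omega> \<partial>block_meas n) \<le> ennreal B" "B \<ge> 0"
    and le: "\<And>x \<omega>. x \<in> A \<Longrightarrow> \<omega> \<in> good (f x) (g x) \<Longrightarrow> ennreal \<kappa> \<le> F x \<omega>"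
  shows "\<kappa> * (\<Sum>x\<in>A. measure (block_meas n) (good (f x) (g x))) \<le> B"
proof -
  interpret prob_space "block_meas n" by (rule prob_space_block_meas)
  have "ennreal (\<kappa> * (\<Sum>x\<in>A. prob (good (f x) (g x)))) = (\<Sum>x\<in>A. ennreal \<kappa> * emeasure (block_meas n) (good (f x) (g x)))"
    using \<kappa> by (simp add: emeasure_eq_measure sum_distrib_left sum_ennreal flip: ennreal_mult')
  also have "\<dots> = (\<Sum>x\<in>A. \<integral>\<^sup>+\<omega>. ennreal \<kappa> * indicator (good (f x) (g x)) \<omega> \<partial>block_meas n)"
    using m by (intro sum.cong refl) (simp add: nn_integral_cmult_indicator)
  also have "\<dots> \<le> (\<Sum>x\<in>A. \<integral>\<^sup>+\<omega>. F x \<omega> \<partial>block_meas n)"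
    using le by (intro sum_mono nn_integral_mono) (auto simp: indicator_def)
  also have "\<dots> \<le> ennreal B" by (rule b(1))
  finally show ?thesis using b(2) by (simp add: ennreal_le_iff)
qed

text \<open>The ratios integrate to at most 1 in total and are at least \<open>\<kappa>\<close> on
  the good events, so these have total mass at most \<open>1 / \<kappa>\<close>. The energy
  threshold turns \<open>exp (- C * energy)\<close> into \<open>exp (- 60 * C * n)\<close>.\<close>

lemma sum_good_le_of_ratio:
  assumes A: "finite A" and m: "\<And>x. x \<in> A \<Longrightarrow> f x < M1 \<and> g x < M2" and v: "v > 0"
    and b: "(\<Sum>x\<in>A. \<integral>\<^sup>+\<omega>. ennreal (of_bool (E x \<omega>) * r x \<omega>) \<partial>block_meas n) \<le> 1"
    and E: "\<And>x \<omega>. x \<in> A \<Longrightarrow> \<omega> \<in> good (f x) (g x) \<Longrightarrow> E x \<omega>"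
    and r: "\<And>x \<omega>. x \<in> A \<Longrightarrow> (1 / v) ^ n * exp (- (real C * energy (f x) (g x) \<omega>)) \<le> r x \<omega>"
  shows "(\<Sum>x\<in>A. measure (block_meas n) (good (f x) (g x))) \<le> v ^ n * exp (60 * C * n)"
proof -
  define \<kappa> where "\<kappa> = (1 / v) ^ n * exp (- (60 * real C * n))"
  have \<kappa>: "\<kappa> > 0" using v by (simp add: \<kappa>_def)
  have "\<kappa> * (\<Sum>x\<in>A. measure (block_meas n) (good (f x) (g x))) \<le> 1"
  proof (rule sum_good_le[OF A m \<kappa>])
    fix x \<omega> assume x: "x \<in> A" and \<omega>: "\<omega> \<in> good (f x) (g x)"
    have "real C * energy (f x) (g x) \<omega> \<le> real C * (60 * n)"
      using \<omega> by (intro mult_left_mono) (auto simp: good_def)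
    then have "\<kappa> \<le> (1 / v) ^ n * exp (- (real C * energy (f x) (g x) \<omega>))"
      unfolding \<kappa>_def using v by (intro mult_left_mono) (auto simp: mult_ac)
    also have "\<dots> \<le> r x \<omega>" by (rule r[OF x])
    finally show "ennreal \<kappa> \<le> ennreal (of_bool (E x \<omega>) * r x \<omega>)"
      using E[OF x \<omega>] by (simp add: ennreal_leI)
  qed (use b in auto)
  then have "(\<Sum>x\<in>A. measure (block_meas n) (good (f x) (g x))) \<le> 1 / \<kappa>"
    using \<kappa> by (simp add: field_simps)
  also have "\<dots> = v ^ n * exp (60 * C * n)"
    by (simp add: \<kappa>_def exp_minus field_simps)
  finally show ?thesis .
qed

text \<open>For each fixed \<open>m1\<close> the good events over all \<open>m2\<close> have mass at
  most \<open>v ^ n * exp (60 * C * n)\<close>, while on average over \<open>m1\<close> this mass is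
  at least \<open>M2 / 2\<close>.\<close>

lemma nmsg2_le_of_ratio:
  assumes n: "n > 0" and err: "err_prob snr n c \<le> 1/4" and v: "v > 0"
    and b: "\<And>m1. m1 < M1 \<Longrightarrow> (\<Sum>m2<M2. \<integral>\<^sup>+\<omega>. ennreal (of_bool (e2 m1 m2 \<omega> = m2) * r m1 m2 \<omega>) \<partial>block_meas n) \<le> 1"
    and r: "\<And>m1 m2 \<omega>. (1 / v) ^ n * exp (- (real C * energy m1 m2 \<omega>)) \<le> r m1 m2 \<omega>"
  shows "real M2 \<le> 2 * v ^ n * exp (60 * C * n)"
proof -
  have "real M1 * real M2 / 2 \<le> (\<Sum>m1<M1. \<Sum>m2<M2. measure (block_meas n) (good m1 m2))"
    by (rule good_mass[OF n err])
  also have "\<dots> \<le> (\<Sum>m1<M1. v ^ n * exp (60 * C * n))"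
    by (intro sum_mono sum_good_le_of_ratio[OF _ _ v b _ r]) (auto simp: good_def)
  finally have "real M1 * (real M2 / 2) \<le> real M1 * (v ^ n * exp (60 * C * n))" by simp
  then show ?thesis using M_pos by simp
qed

lemma nmsg1_le_of_ratio:
  assumes n: "n > 0" and err: "err_prob snr n c \<le> 1/4" and v: "v > 0"
    and b: "\<And>m2. m2 < M2 \<Longrightarrow> (\<Sum>m1<M1. \<integral>\<^sup>+\<omega>. ennreal (of_bool (e1 m1 m2 \<omega> = m1) * r m2 m1 \<omega>) \<partial>block_meas n) \<le> 1"
    and r: "\<And>m1 m2 \<omega>. (1 / v) ^ n * exp (- (real C * energy m1 m2 \<omega>)) \<le> r m2 m1 \<omega>"
  shows "real M1 \<le> 2 * v ^ n * exp (60 * C * n)"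
proof -
  have "real M1 * real M2 / 2 \<le> (\<Sum>m1<M1. \<Sum>m2<M2. measure (block_meas n) (good m1 m2))"
    by (rule good_mass[OF n err])
  also have "\<dots> = (\<Sum>m2<M2. \<Sum>m1<M1. measure (block_meas n) (good m1 m2))"
    by (rule sum.swap)
  also have "\<dots> \<le> (\<Sum>m2<M2. v ^ n * exp (60 * C * n))"
    by (intro sum_mono sum_good_le_of_ratio[OF _ _ v b _ r]) (auto simp: good_def)
  finally have "real M2 * (real M1 / 2) \<le> real M2 * (v ^ n * exp (60 * C * n))" by (simp add: mult.commute)
  then show ?thesis using M_pos by simp
qed

end

section \<open>Bounds on the individual rates\<close>

lemma prod_gden_pos: "v > 0 \<Longrightarrow> (\<Prod>i<n. gden v (u i)) > 0"
  by (intro prod_pos) (auto simp: gden_pos)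

text \<open>Here the energy alone dominates \<open>u\<close>, so the helpful term in
  \<open>w\<close> is dropped and \<open>w\<close> is arbitrary.\<close>

lemma prod_gden_ratio_ge:
  assumes "v > 0" and "\<And>i. i < n \<Longrightarrow> (cmod (u i))\<^sup>2 \<le> v * (C * e i)"
  shows "(1 / v) ^ n * exp (- (C * (\<Sum>i<n. e i))) \<le> (\<Prod>i<n. gden v (u i)) / (\<Prod>i<n. gden 1 (w i))"
proof -
  have "(1 / v) ^ n * exp (- (C * (\<Sum>i<n. e i))) * (\<Prod>i<n. gden 1 (w i)) \<le> (\<Prod>i<n. gden v (u i))"
  proof (rule prod_gden_ge[OF assms(1)])
    fix i assume "i < n"
    from assms(2)[OF this] show "(cmod (u i))\<^sup>2 \<le> v * ((cmod (w i))\<^sup>2 + C * e i)"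
      using assms(1) by (elim order_trans) simp
  qed
  then show ?thesis using prod_gden_pos[of 1 w n] by (simp add: pos_le_divide_eq)
qed

context zicr_code
begin

text \<open>With \<open>m1\<close> and the relay noise fixed, \<open>H32 X3\<close> is a known shift
  on which the test density is centred. What is left is a point-to-point channel of gain
  \<open>snr L22\<close>, and \<open>120 = 60 * 2\<close>.\<close>

lemma nmsg2_le:
  assumes n: "n > 0" and err: "err_prob snr n c \<le> 1/4"
  shows "real M2 \<le> 2 * snr L22 ^ n * exp (120 * n)"
proof -
  define v where "v = snr L22"
  have v: "v \<ge> 1" by (simp add: v_def snr_ge_1)
  define r where "r m1 m2 \<omega> = (\<Prod>i<n. gden v (H L22 \<omega> i * X2 m2 i + noise N2 \<omega> i)) / (\<Prod>i<n. gden 1 (noise N2 \<omega> i))"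
    for m1 m2 :: nat and \<omega>
  have "real M2 \<le> 2 * v ^ n * exp (real (60 * 2 * n))"
  proof (rule nmsg2_le_of_ratio[OF n err])
    fix m1 assume m1: "m1 < M1"
    define s where "s \<omega> m2 i k = H L22 \<omega> i * X2 m2 i + H L32 \<omega> i * X3 m1 \<omega> i" for \<omega> m2 i and k :: node
    show "(\<Sum>m2<M2. \<integral>\<^sup>+\<omega>. ennreal (of_bool (e2 m1 m2 \<omega> = m2) * r m1 m2 \<omega>) \<partial>block_meas n) \<le> 1"
    proof (rule change_of_measure[where K="{N2}" and s=s
        and D="\<lambda>\<omega> y. dec2 c (trunc n (\<lambda>i. y i N2)) (trunc n (H L22 \<omega>)) (trunc n (H L32 \<omega>))"
        and q="\<lambda>\<omega> y. \<Prod>i<n. gden v (y i N2 - H L32 \<omega> i * X3 m1 \<omega> i)"])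
      fix m2 assume "m2 \<in> {..<M2}"
      then have m2: "m2 < M2" by simp
      show "e2 m1 m2 \<in> measurable (block_meas n) (count_space UNIV)"
        using m1 m2 by (rule est_measurable)
      show "r m1 m2 \<in> borel_measurable (block_meas n)"
        unfolding r_def [abs_def]
        by (intro borel_measurable_divide borel_measurable_prod measurable_compose[OF _ gden_measurable]
          borel_measurable_add borel_measurable_times gain_measurable noise_measurable) auto
      fix \<omega> :: sample and z :: "nat \<Rightarrow> node \<Rightarrow> complex"
      show "e2 m1 m2 (resample n {N2} \<omega> z) = dec2 c (trunc n (\<lambda>i. translate n {N2} (s \<omega> m2) z i N2))
          (trunc n (H L22 \<omega>)) (trunc n (H L32 \<omega>))"
        by (rule est2_resample)
          (simp add: out2_def gain_resample noise_resample relay_out_resample translate_apply s_def)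
      \<comment> \<open>The label is the message itself, so the denominator reduces to a single
        noise density.\<close>
      have "{m'. m' \<in> {..<M2} \<and> m' = m2} = {m2}" using m2 by auto
      then show "r m1 m2 (resample n {N2} \<omega> z) = (\<Prod>i<n. gden v (translate n {N2} (s \<omega> m2) z i N2 - H L32 \<omega> i * X3 m1 \<omega> i)) /
         (\<Sum>m' | m' \<in> {..<M2} \<and> m' = m2. noise_dens n {N2} (\<lambda>i k. translate n {N2} (s \<omega> m2) z i k - s \<omega> m' i k))"
        by (simp add: r_def noise_dens_def gain_resample noise_resample translate_apply s_def add.commute)
    next
      fix \<omega> :: sample
      show "(\<lambda>y. \<Prod>i<n. gden v (y i N2 - H L32 \<omega> i * X3 m1 \<omega> i)) \<in> borel_measurable (leb_meas n {N2})"
        by (intro borel_measurable_prod measurable_compose[OF _ gden_measurable] borel_measurable_diff leb_component_measurable) auto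
      show "(\<integral>\<^sup>+y. ennreal (\<Prod>i<n. gden v (y i N2 - H L32 \<omega> i * X3 m1 \<omega> i)) \<partial>leb_meas n {N2}) \<le> 1"
        using v by (subst nn_integral_gaussian_block) auto
    qed (use v in \<open>auto intro!: prod_nonneg simp: gden_pos less_imp_le\<close>)
  next
    fix m1 m2 \<omega>
    show "(1 / v) ^ n * exp (- (real 2 * energy m1 m2 \<omega>)) \<le> r m1 m2 \<omega>"
      unfolding r_def energy_def
    proof (rule prod_gden_ratio_ge)
      fix i
      have "(cmod (H L22 \<omega> i * X2 m2 i + noise N2 \<omega> i))\<^sup>2 \<le> 2 * (v * (cmod (X2 m2 i))\<^sup>2) + 2 * (cmod (noise N2 \<omega> i))\<^sup>2"
        using cmod_add_sq_le[of "H L22 \<omega> i * X2 m2 i" "noise N2 \<omega> i"] by (simp add: cmod_gain_sq v_def)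
      also have "\<dots> \<le> 2 * (v * (cmod (X2 m2 i))\<^sup>2) + 2 * (v * (cmod (noise N2 \<omega> i))\<^sup>2)"
        using mult_right_mono[OF v, of "(cmod (noise N2 \<omega> i))\<^sup>2"] by simp
      also have "\<dots> = v * (2 * ((cmod (X2 m2 i))\<^sup>2 + (cmod (noise N2 \<omega> i))\<^sup>2))" by (simp add: algebra_simps)
      also have "\<dots> \<le> v * (real 2 * sym_energy m1 m2 \<omega> i)"
        using v by (intro mult_left_mono) (auto simp: sym_energy_def)
      finally show "(cmod (H L22 \<omega> i * X2 m2 i + noise N2 \<omega> i))\<^sup>2 \<le> v * (real 2 * sym_energy m1 m2 \<omega> i)" .
    qed (use v in simp)
  qed (use v in simp)
  then show ?thesis by (simp add: v_def)
qed

text \<open>The cut around receiver 1. The relay noise stays fixed, so \<open>m1\<close> determines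
  the whole useful signal \<open>H11 X1 + H31 X3\<close>, whose gains the test variance
  \<open>v\<close> must cover; \<open>X2\<close> is known because \<open>m2\<close> is
  fixed.\<close>

lemma nmsg1_le_relay_to_receiver:
  assumes n: "n > 0" and err: "err_prob snr n c \<le> 1/4" and v11: "snr L11 \<le> v" and v31: "snr L31 \<le> v"
  shows "real M1 \<le> 2 * v ^ n * exp (240 * n)"
proof -
  have v: "v \<ge> 1" using snr_ge_1 v11 by (rule order_trans)
  define u where "u m1 \<omega> i = H L11 \<omega> i * X1 m1 i + H L31 \<omega> i * X3 m1 \<omega> i + noise N1 \<omega> i" for m1 \<omega> i
  define r where "r m2 m1 \<omega> = (\<Prod>i<n. gden v (u m1 \<omega> i)) / (\<Prod>i<n. gden 1 (noise N1 \<omega> i))"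
    for m1 m2 :: nat and \<omega>
  have "real M1 \<le> 2 * v ^ n * exp (real (60 * 4 * n))"
  proof (rule nmsg1_le_of_ratio[OF n err])
    fix m2 assume m2: "m2 < M2"
    define s where "s \<omega> m1 i k = H L11 \<omega> i * X1 m1 i + H L21 \<omega> i * X2 m2 i + H L31 \<omega> i * X3 m1 \<omega> i" for \<omega> m1 i and k :: node
    show "(\<Sum>m1<M1. \<integral>\<^sup>+\<omega>. ennreal (of_bool (e1 m1 m2 \<omega> = m1) * r m2 m1 \<omega>) \<partial>block_meas n) \<le> 1"
    proof (rule change_of_measure[where K="{N1}" and s=s
        and D="\<lambda>\<omega> y. dec1 c (trunc n (\<lambda>i. y i N1)) (trunc n (H L11 \<omega>)) (trunc n (H L21 \<omega>)) (trunc n (H L31 \<omega>))"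
        and q="\<lambda>\<omega> y. \<Prod>i<n. gden v (y i N1 - H L21 \<omega> i * X2 m2 i)"])
      fix m1 assume "m1 \<in> {..<M1}"
      then have m1: "m1 < M1" by simp
      show "e1 m1 m2 \<in> measurable (block_meas n) (count_space UNIV)"
        using m1 m2 by (rule est_measurable)
      show "r m2 m1 \<in> borel_measurable (block_meas n)"
        unfolding r_def [abs_def] u_def using m1
        by (intro borel_measurable_divide borel_measurable_prod measurable_compose[OF _ gden_measurable]
          borel_measurable_add borel_measurable_times gain_measurable noise_measurable relay_measurable) auto
      fix \<omega> :: sample and z :: "nat \<Rightarrow> node \<Rightarrow> complex"
      show "e1 m1 m2 (resample n {N1} \<omega> z) = dec1 c (trunc n (\<lambda>i. translate n {N1} (s \<omega> m1) z i N1))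
          (trunc n (H L11 \<omega>)) (trunc n (H L21 \<omega>)) (trunc n (H L31 \<omega>))"
        by (rule est1_resample)
          (simp add: out1_def gain_resample noise_resample relay_out_resample translate_apply s_def)
      have "{m'. m' \<in> {..<M1} \<and> m' = m1} = {m1}" using m1 by auto
      then show "r m2 m1 (resample n {N1} \<omega> z) = (\<Prod>i<n. gden v (translate n {N1} (s \<omega> m1) z i N1 - H L21 \<omega> i * X2 m2 i)) /
         (\<Sum>m' | m' \<in> {..<M1} \<and> m' = m1. noise_dens n {N1} (\<lambda>i k. translate n {N1} (s \<omega> m1) z i k - s \<omega> m' i k))"
        by (simp add: r_def u_def noise_dens_def gain_resample noise_resample relay_out_resample translate_apply s_def algebra_simps)
    next
      fix \<omega> :: sample
      show "(\<lambda>y. \<Prod>i<n. gden v (y i N1 - H L21 \<omega> i * X2 m2 i)) \<in> borel_measurable (leb_meas n {N1})"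
        by (intro borel_measurable_prod measurable_compose[OF _ gden_measurable] borel_measurable_diff leb_component_measurable) auto
      show "(\<integral>\<^sup>+y. ennreal (\<Prod>i<n. gden v (y i N1 - H L21 \<omega> i * X2 m2 i)) \<partial>leb_meas n {N1}) \<le> 1"
        using v by (subst nn_integral_gaussian_block) auto
    qed (use v in \<open>auto intro!: prod_nonneg simp: gden_pos less_imp_le\<close>)
  next
    fix m1 m2 \<omega>
    show "(1 / v) ^ n * exp (- (real 4 * energy m1 m2 \<omega>)) \<le> r m2 m1 \<omega>"
      unfolding r_def energy_def
    proof (rule prod_gden_ratio_ge)
      fix i
      have "(cmod (u m1 \<omega> i))\<^sup>2 \<le> 2 * (cmod (H L11 \<omega> i * X1 m1 i + H L31 \<omega> i * X3 m1 \<omega> i))\<^sup>2 + 2 * (cmod (noise N1 \<omega> i))\<^sup>2"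
        unfolding u_def by (rule cmod_add_sq_le)
      also have "\<dots> \<le> 4 * (snr L11 * (cmod (X1 m1 i))\<^sup>2) + 4 * (snr L31 * (cmod (X3 m1 \<omega> i))\<^sup>2) + 2 * (1 * (cmod (noise N1 \<omega> i))\<^sup>2)"
        using cmod_add_sq_le[of "H L11 \<omega> i * X1 m1 i" "H L31 \<omega> i * X3 m1 \<omega> i"] by (simp add: cmod_gain_sq)
      also have "\<dots> \<le> 4 * (v * (cmod (X1 m1 i))\<^sup>2) + 4 * (v * (cmod (X3 m1 \<omega> i))\<^sup>2) + 4 * (v * (cmod (noise N1 \<omega> i))\<^sup>2)"
        using v v11 v31 by (intro add_mono mult_mono) (auto simp: snr_pos)
      also have "\<dots> = v * (4 * ((cmod (X1 m1 i))\<^sup>2 + (cmod (X3 m1 \<omega> i))\<^sup>2 + (cmod (noise N1 \<omega> i))\<^sup>2))" by (simp add: algebra_simps)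
      also have "\<dots> \<le> v * (real 4 * sym_energy m1 m2 \<omega> i)"
        using v by (intro mult_left_mono) (auto simp: sym_energy_def)
      finally show "(cmod (u m1 \<omega> i))\<^sup>2 \<le> v * (real 4 * sym_energy m1 m2 \<omega> i)" .
    qed (use v in simp)
  qed (use v in simp)
  then show ?thesis by simp
qed

text \<open>Receiver 1 is given the relay's observation, from which it can compute and cancel the relay signal.
  What remains are two looks at \<open>X1\<close>, at the nodes \<open>k\<close> and \<open>k'\<close>, of which that at \<open>k\<close> is the stronger one.\<close>

lemma nmsg1_le_two_looks:
  assumes n: "n > 0" and err: "err_prob snr n c \<le> 1/4"
    and kk: "{k, k'} = {N1, N3}" "k \<noteq> k'" and L: "L N1 = L11" "L N3 = L13" and le: "snr (L k') \<le> snr (L k)"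
  shows "real M1 \<le> 2 * snr (L k) ^ n * exp (240 * n)"
proof -
  define v where "v = snr (L k)"
  have v: "v \<ge> 1" by (simp add: v_def snr_ge_1)
  define u where "u m1 \<omega> i = H (L k) \<omega> i * X1 m1 i + noise k \<omega> i" for m1 \<omega> i
  \<comment> \<open>The weaker look minus its prediction from the stronger one: \<open>X1\<close>
    cancels and, by \<open>le\<close>, the noise at \<open>k\<close> enters with a coefficient of
    modulus at most 1.\<close>
  define w where "w \<omega> i = noise k' \<omega> i - H (L k') \<omega> i / H (L k) \<omega> i * noise k \<omega> i" for \<omega> i
  define r where "r m2 m1 \<omega> = (\<Prod>i<n. gden v (u m1 \<omega> i) * gden 1 (w \<omega> i)) / (\<Prod>i<n. gden 1 (noise k \<omega> i) * gden 1 (noise k' \<omega> i))"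
    for m1 m2 :: nat and \<omega>
  have "real M1 \<le> 2 * v ^ n * exp (real (60 * 4 * n))"
  proof (rule nmsg1_le_of_ratio[OF n err])
    fix m2 assume m2: "m2 < M2"
    define s where "s \<omega> m1 i l = H (L l) \<omega> i * X1 m1 i" for \<omega> m1 i l
    \<comment> \<open>The block \<open>y\<close> holds \<open>H11 X1 + Z1\<close> at
      \<open>N1\<close> and the relay's full observation at \<open>N3\<close>. The true output of
      receiver 1 is rebuilt from these two without reference to \<open>m1\<close>, as a decoder
      function must be.\<close>
    define y1 where "y1 \<omega> y i = y i N1 + H L21 \<omega> i * X2 m2 i
      + H L31 \<omega> i * relayf c i (trunc i (\<lambda>j. y j N3)) (trunc i (H L13 \<omega>))" for \<omega> i and y :: "nat \<Rightarrow> node \<Rightarrow> complex"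
    show "(\<Sum>m1<M1. \<integral>\<^sup>+\<omega>. ennreal (of_bool (e1 m1 m2 \<omega> = m1) * r m2 m1 \<omega>) \<partial>block_meas n) \<le> 1"
    \<comment> \<open>Only the strong look gets the wide variance \<open>v\<close>; the residual of
      the weak one keeps variance 1, so \<open>v ^ n\<close> is paid once. The term
      \<open>- 0\<close> is the zero mean in the general pair density.\<close>
    proof (rule change_of_measure[where K="{k, k'}" and s=s
        and D="\<lambda>\<omega> y. dec1 c (trunc n (y1 \<omega> y)) (trunc n (H L11 \<omega>)) (trunc n (H L21 \<omega>)) (trunc n (H L31 \<omega>))"
        and q="\<lambda>\<omega> y. \<Prod>i<n. gden v (y i k - 0) * gden 1 (y i k' - H (L k') \<omega> i / H (L k) \<omega> i * y i k)"])
      fix m1 assume "m1 \<in> {..<M1}"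
      then have m1: "m1 < M1" by simp
      show "e1 m1 m2 \<in> measurable (block_meas n) (count_space UNIV)"
        using m1 m2 by (rule est_measurable)
      show "r m2 m1 \<in> borel_measurable (block_meas n)"
        unfolding r_def [abs_def] u_def w_def using m1
        by (intro borel_measurable_divide borel_measurable_prod measurable_compose[OF _ gden_measurable]
          borel_measurable_add borel_measurable_diff borel_measurable_times gain_measurable noise_measurable) auto
      fix \<omega> :: sample and z :: "nat \<Rightarrow> node \<Rightarrow> complex"
      show "e1 m1 m2 (resample n {k, k'} \<omega> z) = dec1 c (trunc n (y1 \<omega> (translate n {k, k'} (s \<omega> m1) z)))
          (trunc n (H L11 \<omega>)) (trunc n (H L21 \<omega>)) (trunc n (H L31 \<omega>))"
      proof (rule est1_resample)
        fix i assume i: "i < n"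
        have "trunc i (relay_in c snr m1 (resample n {N1, N3} \<omega> z)) = trunc i (\<lambda>j. translate n {N1, N3} (s \<omega> m1) z j N3)"
          "trunc i (H L13 (resample n {N1, N3} \<omega> z)) = trunc i (H L13 \<omega>)"
          using i by (auto intro!: trunc_cong simp: relay_in_def gain_resample noise_resample translate_apply s_def L)
        then show "out1 c snr m1 m2 (resample n {k, k'} \<omega> z) i = y1 \<omega> (translate n {k, k'} (s \<omega> m1) z) i"
          unfolding kk using i
          by (simp add: out1_def relay_out_def y1_def gain_resample noise_resample translate_apply s_def L)
      qed
      have "{m'. m' \<in> {..<M1} \<and> m' = m1} = {m1}" using m1 by auto
      then show "r m2 m1 (resample n {k, k'} \<omega> z) = (\<Prod>i<n. gden v (translate n {k, k'} (s \<omega> m1) z i k - 0)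
           * gden 1 (translate n {k, k'} (s \<omega> m1) z i k' - H (L k') \<omega> i / H (L k) \<omega> i * translate n {k, k'} (s \<omega> m1) z i k)) /
         (\<Sum>m' | m' \<in> {..<M1} \<and> m' = m1. noise_dens n {k, k'} (\<lambda>i l. translate n {k, k'} (s \<omega> m1) z i l - s \<omega> m' i l))"
        using kk(2) gain_nz
        by (simp add: r_def u_def w_def noise_dens_def gain_resample noise_resample translate_apply s_def add.commute distrib_left)
    next
      fix \<omega> :: sample
      show "(\<lambda>y. \<Prod>i<n. gden v (y i k - 0) * gden 1 (y i k' - H (L k') \<omega> i / H (L k) \<omega> i * y i k)) \<in> borel_measurable (leb_meas n {k, k'})"
        by (intro borel_measurable_prod borel_measurable_times measurable_compose[OF _ gden_measurable] borel_measurable_diff leb_component_measurable) auto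
      show "(\<integral>\<^sup>+y. ennreal (\<Prod>i<n. gden v (y i k - 0) * gden 1 (y i k' - H (L k') \<omega> i / H (L k) \<omega> i * y i k)) \<partial>leb_meas n {k, k'}) \<le> 1"
        using v kk(2) by (subst nn_integral_gaussian_pair_block) auto
    qed (use v in \<open>auto intro!: prod_nonneg mult_nonneg_nonneg simp: gden_pos less_imp_le\<close>)
  next
    fix m1 m2 \<omega>
    have e: "(cmod (X1 m1 i))\<^sup>2 + (cmod (noise k \<omega> i))\<^sup>2 + (cmod (noise k' \<omega> i))\<^sup>2 \<le> sym_energy m1 m2 \<omega> i" for i
      using kk by (auto simp: sym_energy_def doubleton_eq_iff)
    have "(1 / v) ^ n * exp (- (2 * energy m1 m2 \<omega>)) \<le> (\<Prod>i<n. gden v (u m1 \<omega> i)) / (\<Prod>i<n. gden 1 (noise k \<omega> i))"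
      unfolding energy_def
    proof (rule prod_gden_ratio_ge)
      fix i
      have "(cmod (u m1 \<omega> i))\<^sup>2 \<le> 2 * (v * (cmod (X1 m1 i))\<^sup>2) + 2 * (1 * (cmod (noise k \<omega> i))\<^sup>2)"
        using cmod_add_sq_le[of "H (L k) \<omega> i * X1 m1 i" "noise k \<omega> i"] by (simp add: cmod_gain_sq v_def u_def)
      also have "\<dots> \<le> 2 * (v * (cmod (X1 m1 i))\<^sup>2) + 2 * (v * (cmod (noise k \<omega> i))\<^sup>2)"
        using v by (intro add_mono mult_mono) auto
      also have "\<dots> = v * (2 * ((cmod (X1 m1 i))\<^sup>2 + (cmod (noise k \<omega> i))\<^sup>2))" by (simp add: algebra_simps)
      also have "\<dots> \<le> v * (2 * sym_energy m1 m2 \<omega> i)"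
        using v e[of i] by (intro mult_left_mono) (auto intro: order_trans[rotated])
      finally show "(cmod (u m1 \<omega> i))\<^sup>2 \<le> v * (2 * sym_energy m1 m2 \<omega> i)" .
    qed (use v in simp)
    moreover have "(1 / 1) ^ n * exp (- (2 * energy m1 m2 \<omega>)) \<le> (\<Prod>i<n. gden 1 (w \<omega> i)) / (\<Prod>i<n. gden 1 (noise k' \<omega> i))"
      unfolding energy_def
    proof (rule prod_gden_ratio_ge)
      fix i
      have "(cmod (w \<omega> i))\<^sup>2 \<le> 2 * (cmod (noise k' \<omega> i))\<^sup>2 + 2 * (cmod (H (L k') \<omega> i / H (L k) \<omega> i * noise k \<omega> i))\<^sup>2"
        using cmod_add_sq_le[of "noise k' \<omega> i" "- (H (L k') \<omega> i / H (L k) \<omega> i * noise k \<omega> i)"] by (simp add: w_def)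
      also have "\<dots> = 2 * (cmod (noise k' \<omega> i))\<^sup>2 + 2 * (snr (L k') / snr (L k) * (cmod (noise k \<omega> i))\<^sup>2)"
        by (simp only: cmod_gain_ratio_sq)
      also have "\<dots> \<le> 2 * (cmod (noise k' \<omega> i))\<^sup>2 + 2 * (1 * (cmod (noise k \<omega> i))\<^sup>2)"
        using le snr_pos[of "L k"] snr_pos[of "L k'"] by (intro add_mono mult_mono order_refl) auto
      also have "\<dots> \<le> 2 * sym_energy m1 m2 \<omega> i"
        using e[of i] zero_le_power2[of "cmod (X1 m1 i)"] by linarith
      finally show "(cmod (w \<omega> i))\<^sup>2 \<le> 1 * (2 * sym_energy m1 m2 \<omega> i)" by simp
    qed simp
    ultimately have "((1 / v) ^ n * exp (- (2 * energy m1 m2 \<omega>))) * ((1 / 1) ^ n * exp (- (2 * energy m1 m2 \<omega>))) \<le> r m2 m1 \<omega>"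
      unfolding r_def prod.distrib times_divide_times_eq[symmetric]
      using v prod_gden_pos[of v "u m1 \<omega>" n] prod_gden_pos[of 1 "noise k \<omega>" n] by (intro mult_mono) auto
    then show "(1 / v) ^ n * exp (- (real 4 * energy m1 m2 \<omega>)) \<le> r m2 m1 \<omega>"
      by (simp add: mult.assoc flip: exp_add)
  qed (use v in simp)
  then show ?thesis by (simp add: v_def)
qed

end

section \<open>The sum-rate bound\<close>

context zicr_code
begin

text \<open>The variance \<open>v1\<close> has to cover the direct signal, the interference, the
  noise of receiver 1 and the ratio of the relay gains, by which distances at receiver 2 are
  magnified at receiver 1. The variance \<open>v2\<close> covers the relay signal at receiver 2 and
  the noise \<open>Z1\<close> that enters with \<open>(H22 / H21) S\<close>. The factor 2 in the
  conditions on \<open>v1\<close> comes from splitting one square while the term in \<open>w\<close>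
  must keep coefficient 1.\<close>

lemma nmsg_prod_le:
  assumes n: "n > 0" and err: "err_prob snr n c \<le> 1/4"
    and v1: "2 \<le> v1" "2 * snr L11 \<le> v1" "2 * snr L21 \<le> v1" "2 * (snr L31 / snr L32) \<le> v1"
    and v2: "1 \<le> v2" "snr L32 \<le> v2" "snr L22 / snr L21 \<le> v2"
  shows "real M1 * real M2 \<le> 4 * (v1 * v2) ^ n * exp (480 * n)"
proof -
  interpret prob_space "block_meas n" by (rule prob_space_block_meas)
  define A where "A = {..<M1} \<times> {..<M2}"
  have A: "finite A" by (simp add: A_def)
  define s1 where "s1 \<omega> x i k = H L11 \<omega> i * X1 (fst x) i + H L21 \<omega> i * X2 (snd x) i + H L31 \<omega> i * X3 (fst x) \<omega> i"
    for \<omega> i and x :: "nat \<times> nat" and k :: node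
  \<comment> \<open>The slot \<open>N1\<close> carries the side information \<open>S\<close>. It
    uses the very noise of receiver 1, which makes the mixture of \<open>S\<close> the same number
    in both ratios.\<close>
  define s2 where "s2 \<omega> x i k = (if k = N1 then H L21 \<omega> i * X2 (snd x) i
      else H L22 \<omega> i * X2 (snd x) i + H L32 \<omega> i * X3 (fst x) \<omega> i)"
    for \<omega> i and x :: "nat \<times> nat" and k :: node
  define q1 where "q1 \<omega> y = (\<Sum>m<M1. \<Prod>i<n. gden v1 (y i N1 - H L31 \<omega> i * X3 m \<omega> i)) / real (card {..<M1})"
    for \<omega> and y :: "nat \<Rightarrow> node \<Rightarrow> complex"
  define q2 where "q2 \<omega> y = (\<Sum>m<M2. \<Prod>i<n. gden 1 (y i N1 - H L21 \<omega> i * X2 m i)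
      * gden v2 (y i N2 - H L22 \<omega> i / H L21 \<omega> i * y i N1)) / real (card {..<M2})"
    for \<omega> and y :: "nat \<Rightarrow> node \<Rightarrow> complex"
  \<comment> \<open>The denominators are sums, not averages, over the message that the receiver does
    not decode; the weights \<open>1 / M1\<close> and \<open>1 / M2\<close> sit in \<open>q1\<close>
    and \<open>q2\<close>.\<close>
  define r1 where "r1 x \<omega> = q1 \<omega> (\<lambda>i k. noise k \<omega> i + s1 \<omega> x i k)
      / (\<Sum>m<M2. noise_dens n {N1} (\<lambda>i k. noise k \<omega> i + s1 \<omega> x i k - s1 \<omega> (fst x, m) i k))" for x \<omega>
  define r2 where "r2 x \<omega> = q2 \<omega> (\<lambda>i k. noise k \<omega> i + s2 \<omega> x i k)
      / (\<Sum>m<M1. noise_dens n {N1, N2} (\<lambda>i k. noise k \<omega> i + s2 \<omega> x i k - s2 \<omega> (m, snd x) i k))" for x \<omega>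
  note meas = borel_measurable_divide borel_measurable_sum borel_measurable_prod borel_measurable_times
    measurable_compose[OF _ gden_measurable] borel_measurable_diff borel_measurable_add
    leb_component_measurable gain_measurable noise_measurable relay_measurable borel_measurable_const
  have s1_meas: "(\<lambda>\<omega>. s1 \<omega> x i k) \<in> borel_measurable (block_meas n)" if "fst x < M1" "i < n" for x i k
    unfolding s1_def using that by (intro meas) auto
  have s2_meas: "(\<lambda>\<omega>. s2 \<omega> x i k) \<in> borel_measurable (block_meas n)" if "fst x < M1" "i < n" for x i k
    unfolding s2_def using that by (intro measurable_If meas) auto
  have r1_meas: "r1 x \<in> borel_measurable (block_meas n)" if "x \<in> A" for x
    unfolding r1_def [abs_def] q1_def noise_dens_def using that
    by (intro meas s1_meas) (auto simp: A_def)
  have r2_meas: "r2 x \<in> borel_measurable (block_meas n)" if "x \<in> A" for x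
    unfolding r2_def [abs_def] q2_def noise_dens_def using that
    by (intro meas s2_meas) (auto simp: A_def)
  have e_meas: "(\<lambda>\<omega>. e1 (fst x) (snd x) \<omega>) \<in> measurable (block_meas n) (count_space UNIV)"
    "(\<lambda>\<omega>. e2 (fst x) (snd x) \<omega>) \<in> measurable (block_meas n) (count_space UNIV)" if "x \<in> A" for x
    using that est_measurable[of "fst x" "snd x"] by (auto simp: A_def)

  have B1: "(\<Sum>x\<in>A. \<integral>\<^sup>+\<omega>. ennreal (of_bool (e1 (fst x) (snd x) \<omega> = fst x) * r1 x \<omega>) \<partial>block_meas n) \<le> 1"
  proof (rule change_of_measure[where K="{N1}" and s=s1 and q=q1
      and D="\<lambda>\<omega> y. dec1 c (trunc n (\<lambda>i. y i N1)) (trunc n (H L11 \<omega>)) (trunc n (H L21 \<omega>)) (trunc n (H L31 \<omega>))"])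
    fix x \<omega> and z :: "nat \<Rightarrow> node \<Rightarrow> complex" assume x: "x \<in> A"
    show "e1 (fst x) (snd x) (resample n {N1} \<omega> z) = dec1 c (trunc n (\<lambda>i. translate n {N1} (s1 \<omega> x) z i N1))
        (trunc n (H L11 \<omega>)) (trunc n (H L21 \<omega>)) (trunc n (H L31 \<omega>))"
      by (rule est1_resample)
        (simp add: out1_def gain_resample noise_resample relay_out_resample translate_apply s1_def)
    have "{x'. x' \<in> A \<and> fst x' = fst x} = (\<lambda>m. (fst x, m)) ` {..<M2}"
      using x by (auto simp: A_def)
    then have "(\<Sum>x' | x' \<in> A \<and> fst x' = fst x. noise_dens n {N1} (\<lambda>i k. translate n {N1} (s1 \<omega> x) z i k - s1 \<omega> x' i k))
        = (\<Sum>m<M2. noise_dens n {N1} (\<lambda>i k. translate n {N1} (s1 \<omega> x) z i k - s1 \<omega> (fst x, m) i k))"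
      by (simp add: sum.reindex inj_on_def)
    then show "r1 x (resample n {N1} \<omega> z) = q1 \<omega> (translate n {N1} (s1 \<omega> x) z)
        / (\<Sum>x' | x' \<in> A \<and> fst x' = fst x. noise_dens n {N1} (\<lambda>i k. translate n {N1} (s1 \<omega> x) z i k - s1 \<omega> x' i k))"
      by (simp add: r1_def q1_def noise_dens_def gain_resample noise_resample relay_out_resample translate_apply s1_def)
  next
    fix \<omega>
    show "q1 \<omega> \<in> borel_measurable (leb_meas n {N1})"
      unfolding q1_def [abs_def] by (intro meas) auto
    have "(\<integral>\<^sup>+y. ennreal (q1 \<omega> y) \<partial>leb_meas n {N1}) = 1"
      unfolding q1_def
    proof (rule nn_integral_average)
      fix m show "(\<integral>\<^sup>+y. ennreal (\<Prod>i<n. gden v1 (y i N1 - H L31 \<omega> i * X3 m \<omega> i)) \<partial>leb_meas n {N1}) = 1"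
        using v1 by (intro nn_integral_gaussian_block) simp
      show "(\<lambda>y. \<Prod>i<n. gden v1 (y i N1 - H L31 \<omega> i * X3 m \<omega> i)) \<in> borel_measurable (leb_meas n {N1})"
        by (intro meas) auto
    qed (use M_pos v1 in \<open>auto intro!: prod_nonneg simp: gden_pos less_imp_le lessThan_empty_iff\<close>)
    then show "(\<integral>\<^sup>+y. ennreal (q1 \<omega> y) \<partial>leb_meas n {N1}) \<le> 1" by simp
  qed (use v1 A r1_meas e_meas in \<open>auto intro!: divide_nonneg_nonneg sum_nonneg prod_nonneg simp: q1_def gden_pos less_imp_le\<close>)

  have B2: "(\<Sum>x\<in>A. \<integral>\<^sup>+\<omega>. ennreal (of_bool (e2 (fst x) (snd x) \<omega> = snd x) * r2 x \<omega>) \<partial>block_meas n) \<le> 1"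
  \<comment> \<open>The decoder reads only the slot \<open>N2\<close>: side information enlarges the
    observation, and the given decoder ignores it.\<close>
  proof (rule change_of_measure[where K="{N1, N2}" and s=s2 and q=q2
      and D="\<lambda>\<omega> y. dec2 c (trunc n (\<lambda>i. y i N2)) (trunc n (H L22 \<omega>)) (trunc n (H L32 \<omega>))"])
    fix x \<omega> and z :: "nat \<Rightarrow> node \<Rightarrow> complex" assume x: "x \<in> A"
    show "e2 (fst x) (snd x) (resample n {N1, N2} \<omega> z) = dec2 c (trunc n (\<lambda>i. translate n {N1, N2} (s2 \<omega> x) z i N2))
        (trunc n (H L22 \<omega>)) (trunc n (H L32 \<omega>))"
      by (rule est2_resample)
        (simp add: out2_def gain_resample noise_resample relay_out_resample translate_apply s2_def)
    have "{x'. x' \<in> A \<and> snd x' = snd x} = (\<lambda>m. (m, snd x)) ` {..<M1}"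
      using x by (auto simp: A_def)
    then have "(\<Sum>x' | x' \<in> A \<and> snd x' = snd x. noise_dens n {N1, N2} (\<lambda>i k. translate n {N1, N2} (s2 \<omega> x) z i k - s2 \<omega> x' i k))
        = (\<Sum>m<M1. noise_dens n {N1, N2} (\<lambda>i k. translate n {N1, N2} (s2 \<omega> x) z i k - s2 \<omega> (m, snd x) i k))"
      by (simp add: sum.reindex inj_on_def)
    then show "r2 x (resample n {N1, N2} \<omega> z) = q2 \<omega> (translate n {N1, N2} (s2 \<omega> x) z)
        / (\<Sum>x' | x' \<in> A \<and> snd x' = snd x. noise_dens n {N1, N2} (\<lambda>i k. translate n {N1, N2} (s2 \<omega> x) z i k - s2 \<omega> x' i k))"
      by (simp add: r2_def q2_def noise_dens_def gain_resample noise_resample relay_out_resample translate_apply s2_def)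
  next
    fix \<omega>
    show "q2 \<omega> \<in> borel_measurable (leb_meas n {N1, N2})"
      unfolding q2_def [abs_def] by (intro meas) auto
    have "(\<integral>\<^sup>+y. ennreal (q2 \<omega> y) \<partial>leb_meas n {N1, N2}) = 1"
      unfolding q2_def
    proof (rule nn_integral_average)
      fix m show "(\<integral>\<^sup>+y. ennreal (\<Prod>i<n. gden 1 (y i N1 - H L21 \<omega> i * X2 m i)
          * gden v2 (y i N2 - H L22 \<omega> i / H L21 \<omega> i * y i N1)) \<partial>leb_meas n {N1, N2}) = 1"
        using v2 by (intro nn_integral_gaussian_pair_block) auto
      show "(\<lambda>y. \<Prod>i<n. gden 1 (y i N1 - H L21 \<omega> i * X2 m i)
          * gden v2 (y i N2 - H L22 \<omega> i / H L21 \<omega> i * y i N1)) \<in> borel_measurable (leb_meas n {N1, N2})"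
        by (intro meas) auto
    qed (use M_pos v2 in \<open>auto intro!: prod_nonneg mult_nonneg_nonneg simp: gden_pos less_imp_le lessThan_empty_iff\<close>)
    then show "(\<integral>\<^sup>+y. ennreal (q2 \<omega> y) \<partial>leb_meas n {N1, N2}) \<le> 1" by simp
  qed (use v2 A r2_meas e_meas in \<open>auto intro!: divide_nonneg_nonneg sum_nonneg prod_nonneg mult_nonneg_nonneg simp: q2_def gden_pos less_imp_le\<close>)

  have ratio: "(1 / (v1 * v2)) ^ n * exp (- (8 * energy m1 m2 \<omega>)) / (real M1 * real M2) \<le> r1 (m1, m2) \<omega> * r2 (m1, m2) \<omega>"
    and r_nonneg: "0 \<le> r1 (m1, m2) \<omega>" "0 \<le> r2 (m1, m2) \<omega>" for m1 m2 \<omega>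
  proof -
    define E where "E = energy m1 m2 \<omega>"
    \<comment> \<open>\<open>F\<close> is the unnormalized mixture density of \<open>S\<close> at
      its actual value: the denominator of \<open>r1\<close>, where the parts due to
      \<open>m1\<close> drop out, and a factor of the numerator of \<open>r2\<close>. In the product
      \<open>F\<close> cancels, and \<open>Q / V\<close> and \<open>G / Z\<close> remain.\<close>
    define F where "F = (\<Sum>m<M2. \<Prod>i<n. gden 1 (noise N1 \<omega> i + H L21 \<omega> i * X2 m2 i - H L21 \<omega> i * X2 m i))"
    define u where "u m i = noise N1 \<omega> i + (H L11 \<omega> i * X1 m1 i + H L21 \<omega> i * X2 m2 i + H L31 \<omega> i * X3 m1 \<omega> i) - H L31 \<omega> i * X3 m \<omega> i" for m i
    define w where "w m i = noise N2 \<omega> i + H L32 \<omega> i * X3 m1 \<omega> i - H L32 \<omega> i * X3 m \<omega> i" for m i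
    define t where "t i = H L32 \<omega> i * X3 m1 \<omega> i + (noise N2 \<omega> i - H L22 \<omega> i / H L21 \<omega> i * noise N1 \<omega> i)" for i
    define Q where "Q = (\<Sum>m<M1. \<Prod>i<n. gden v1 (u m i))"
    define V where "V = (\<Sum>m<M1. \<Prod>i<n. gden 1 (w m i))"
    define G where "G = (\<Prod>i<n. gden v2 (t i))"
    define Z where "Z = (\<Prod>i<n. gden 1 (noise N1 \<omega> i))"
    have pos: "F > 0" "V > 0" "Q > 0" "G > 0" "Z > 0"
      using M_pos v1 v2 unfolding F_def V_def Q_def G_def Z_def
      by (auto intro!: sum_pos prod_gden_pos simp: lessThan_empty_iff)
    have r1: "r1 (m1, m2) \<omega> = Q / real M1 / F"
      by (simp add: r1_def q1_def Q_def F_def u_def noise_dens_def s1_def algebra_simps)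
    \<comment> \<open>Subtracting \<open>(H22 / H21) S\<close> removes \<open>H22 X2\<close> exactly
      and leaves a scaled copy of \<open>Z1\<close> behind.\<close>
    have t_eq: "noise N2 \<omega> i + (H L22 \<omega> i * X2 m2 i + H L32 \<omega> i * X3 m1 \<omega> i)
        - H L22 \<omega> i / H L21 \<omega> i * (noise N1 \<omega> i + H L21 \<omega> i * X2 m2 i) = t i" for i
      using gain_nz by (simp add: t_def field_simps)
    have w_eq: "noise N2 \<omega> i + (H L22 \<omega> i * X2 m2 i + H L32 \<omega> i * X3 m1 \<omega> i)
        - (H L22 \<omega> i * X2 m2 i + H L32 \<omega> i * X3 m \<omega> i) = w m i" for m i
      by (simp add: w_def)
    have r2: "r2 (m1, m2) \<omega> = F * G / real M2 / (Z * V)"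
      by (simp add: r2_def q2_def F_def G_def Z_def V_def noise_dens_def s2_def w_eq t_eq prod.distrib
          sum_distrib_right sum_distrib_left del: times_divide_eq_left)
    show "0 \<le> r1 (m1, m2) \<omega>" "0 \<le> r2 (m1, m2) \<omega>"
      using pos by (simp_all add: r1 r2)
    have Q_ge: "(1 / v1) ^ n * exp (- (4 * E)) * V \<le> Q"
    proof -
      have "(1 / v1) ^ n * exp (- (4 * E)) * (\<Prod>i<n. gden 1 (w m i)) \<le> (\<Prod>i<n. gden v1 (u m i))" for m
        unfolding E_def energy_def
      proof (rule prod_gden_ge)
        fix i
        \<comment> \<open>The differences of the centres \<open>H31 X3\<close> are
          \<open>\<rho>\<close> times those of \<open>H32 X3\<close>. Adding and subtracting
          \<open>\<rho> * noise N2\<close> turns them into \<open>\<rho> * w m\<close>, with a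
          remainder \<open>a\<close> that does not involve \<open>m\<close> and is bounded by the
          energy.\<close>
        define \<rho> where "\<rho> = H L31 \<omega> i / H L32 \<omega> i"
        define a where "a = (H L11 \<omega> i * X1 m1 i + H L21 \<omega> i * X2 m2 i) + (noise N1 \<omega> i + - (\<rho> * noise N2 \<omega> i))"
        have "u m i = a + \<rho> * w m i"
          using gain_nz by (simp add: u_def a_def w_def \<rho>_def field_simps)
        then have "(cmod (u m i))\<^sup>2 \<le> 2 * (cmod a)\<^sup>2 + 2 * (cmod (\<rho> * w m i))\<^sup>2"
          using cmod_add_sq_le by simp
        also have "\<dots> \<le> 2 * (2 * (cmod (H L11 \<omega> i * X1 m1 i + H L21 \<omega> i * X2 m2 i))\<^sup>2
            + 2 * (cmod (noise N1 \<omega> i + - (\<rho> * noise N2 \<omega> i)))\<^sup>2) + 2 * (cmod (\<rho> * w m i))\<^sup>2"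
          unfolding a_def by (intro add_right_mono mult_left_mono cmod_add_sq_le) simp
        also have "\<dots> \<le> 2 * (2 * (2 * (cmod (H L11 \<omega> i * X1 m1 i))\<^sup>2 + 2 * (cmod (H L21 \<omega> i * X2 m2 i))\<^sup>2)
            + 2 * (2 * (cmod (noise N1 \<omega> i))\<^sup>2 + 2 * (cmod (- (\<rho> * noise N2 \<omega> i)))\<^sup>2)) + 2 * (cmod (\<rho> * w m i))\<^sup>2"
          by (intro add_right_mono mult_left_mono add_mono cmod_add_sq_le) simp_all
        also have "\<dots> = 4 * ((2 * snr L11) * (cmod (X1 m1 i))\<^sup>2) + 4 * ((2 * snr L21) * (cmod (X2 m2 i))\<^sup>2)
            + 4 * (2 * (cmod (noise N1 \<omega> i))\<^sup>2) + 4 * ((2 * (snr L31 / snr L32)) * (cmod (noise N2 \<omega> i))\<^sup>2)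
            + (2 * (snr L31 / snr L32)) * (cmod (w m i))\<^sup>2"
          unfolding norm_minus_cancel \<rho>_def cmod_gain_sq cmod_gain_ratio_sq by (simp add: algebra_simps)
        also have "\<dots> \<le> 4 * (v1 * (cmod (X1 m1 i))\<^sup>2) + 4 * (v1 * (cmod (X2 m2 i))\<^sup>2)
            + 4 * (v1 * (cmod (noise N1 \<omega> i))\<^sup>2) + 4 * (v1 * (cmod (noise N2 \<omega> i))\<^sup>2) + v1 * (cmod (w m i))\<^sup>2"
          using v1 by (intro add_mono mult_left_mono mult_right_mono) auto
        also have "\<dots> = v1 * ((cmod (w m i))\<^sup>2 + 4 * ((cmod (X1 m1 i))\<^sup>2 + (cmod (X2 m2 i))\<^sup>2
            + (cmod (noise N1 \<omega> i))\<^sup>2 + (cmod (noise N2 \<omega> i))\<^sup>2))"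
          by (simp add: algebra_simps)
        also have "\<dots> \<le> v1 * ((cmod (w m i))\<^sup>2 + 4 * sym_energy m1 m2 \<omega> i)"
          using v1 by (intro mult_left_mono) (auto simp: sym_energy_def)
        finally show "(cmod (u m i))\<^sup>2 \<le> v1 * ((cmod (w m i))\<^sup>2 + 4 * sym_energy m1 m2 \<omega> i)" .
      qed (use v1 in simp)
      then show ?thesis
        unfolding Q_def V_def sum_distrib_left by (intro sum_mono)
    qed
    have G_ge: "(1 / v2) ^ n * exp (- (4 * E)) \<le> G / Z"
      unfolding G_def Z_def E_def energy_def
    proof (rule prod_gden_ratio_ge)
      fix i
      let ?\<rho> = "H L22 \<omega> i / H L21 \<omega> i"
      have "(cmod (t i))\<^sup>2 \<le> 2 * (cmod (H L32 \<omega> i * X3 m1 \<omega> i))\<^sup>2 + 2 * (cmod (noise N2 \<omega> i + - (?\<rho> * noise N1 \<omega> i)))\<^sup>2"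
        using cmod_add_sq_le by (simp add: t_def)
      also have "\<dots> \<le> 2 * (cmod (H L32 \<omega> i * X3 m1 \<omega> i))\<^sup>2
          + 2 * (2 * (cmod (noise N2 \<omega> i))\<^sup>2 + 2 * (cmod (- (?\<rho> * noise N1 \<omega> i)))\<^sup>2)"
        by (intro add_left_mono mult_left_mono cmod_add_sq_le) simp
      also have "\<dots> = 2 * (snr L32 * (cmod (X3 m1 \<omega> i))\<^sup>2) + 4 * (1 * (cmod (noise N2 \<omega> i))\<^sup>2)
          + 4 * ((snr L22 / snr L21) * (cmod (noise N1 \<omega> i))\<^sup>2)"
        unfolding norm_minus_cancel cmod_gain_sq cmod_gain_ratio_sq by (simp add: algebra_simps)
      also have "\<dots> \<le> 4 * (v2 * (cmod (X3 m1 \<omega> i))\<^sup>2) + 4 * (v2 * (cmod (noise N2 \<omega> i))\<^sup>2)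
          + 4 * (v2 * (cmod (noise N1 \<omega> i))\<^sup>2)"
        using v2 by (intro add_mono mult_mono mult_right_mono) (auto simp: snr_pos)
      also have "\<dots> = v2 * (4 * ((cmod (X3 m1 \<omega> i))\<^sup>2 + (cmod (noise N2 \<omega> i))\<^sup>2 + (cmod (noise N1 \<omega> i))\<^sup>2))"
        by (simp add: algebra_simps)
      also have "\<dots> \<le> v2 * (4 * sym_energy m1 m2 \<omega> i)"
        using v2 by (intro mult_left_mono) (auto simp: sym_energy_def)
      finally show "(cmod (t i))\<^sup>2 \<le> v2 * (4 * sym_energy m1 m2 \<omega> i)" .
    qed (use v2 in simp)
    have "(1 / (v1 * v2)) ^ n * exp (- (8 * E)) = ((1 / v1) ^ n * exp (- (4 * E))) * ((1 / v2) ^ n * exp (- (4 * E)))"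
      by (simp add: power_mult_distrib power_divide flip: exp_add)
    also have "\<dots> \<le> (Q / V) * (G / Z)"
      using Q_ge G_ge pos v1 v2 by (intro mult_mono) (auto simp: pos_le_divide_eq)
    finally have "(1 / (v1 * v2)) ^ n * exp (- (8 * E)) / (real M1 * real M2) \<le> (Q / V) * (G / Z) / (real M1 * real M2)"
      by (intro divide_right_mono) auto
    also have "\<dots> = r1 (m1, m2) \<omega> * r2 (m1, m2) \<omega>"
      using pos by (simp add: r1 r2 field_simps)
    finally show "(1 / (v1 * v2)) ^ n * exp (- (8 * energy m1 m2 \<omega>)) / (real M1 * real M2) \<le> r1 (m1, m2) \<omega> * r2 (m1, m2) \<omega>"
      by (simp add: E_def)
  qed

  \<comment> \<open>The lower bound for \<open>r1 * r2\<close> at energy \<open>60 * n\<close>: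
    \<open>480 = 8 * 60\<close>, and \<open>1 / (M1 * M2)\<close> comes from the mixture
    weights.\<close>
  define \<kappa> where "\<kappa> = (1 / (v1 * v2)) ^ n * exp (- (480 * real n)) / (real M1 * real M2)"
  have \<kappa>: "\<kappa> > 0" using v1 v2 M_pos by (simp add: \<kappa>_def)
  \<comment> \<open>On a good event both indicators are 1 and
    \<open>r1 + r2 \<ge> 2 * sqrt (r1 * r2)\<close>; the bounds \<open>B1\<close> and
    \<open>B2\<close> add up to 2.\<close>
  have "(2 * sqrt \<kappa>) * (\<Sum>x\<in>A. prob (good (fst x) (snd x))) \<le> 2"
  proof (rule sum_good_le[OF A, where F="\<lambda>x \<omega>. ennreal (of_bool (e1 (fst x) (snd x) \<omega> = fst x) * r1 x \<omega>)
      + ennreal (of_bool (e2 (fst x) (snd x) \<omega> = snd x) * r2 x \<omega>)"])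
    show "(\<Sum>x\<in>A. \<integral>\<^sup>+\<omega>. ennreal (of_bool (e1 (fst x) (snd x) \<omega> = fst x) * r1 x \<omega>)
      + ennreal (of_bool (e2 (fst x) (snd x) \<omega> = snd x) * r2 x \<omega>) \<partial>block_meas n) \<le> ennreal 2"
    proof -
      have m: "(\<lambda>\<omega>. ennreal (of_bool (e1 (fst x) (snd x) \<omega> = fst x) * r1 x \<omega>)) \<in> borel_measurable (block_meas n)"
        "(\<lambda>\<omega>. ennreal (of_bool (e2 (fst x) (snd x) \<omega> = snd x) * r2 x \<omega>)) \<in> borel_measurable (block_meas n)" if "x \<in> A" for x
      proof -
        note [measurable] = e_meas[OF that] r1_meas[OF that] r2_meas[OF that]
        show "(\<lambda>\<omega>. ennreal (of_bool (e1 (fst x) (snd x) \<omega> = fst x) * r1 x \<omega>)) \<in> borel_measurable (block_meas n)"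
          "(\<lambda>\<omega>. ennreal (of_bool (e2 (fst x) (snd x) \<omega> = snd x) * r2 x \<omega>)) \<in> borel_measurable (block_meas n)"
          by measurable
      qed
      have "(\<Sum>x\<in>A. \<integral>\<^sup>+\<omega>. ennreal (of_bool (e1 (fst x) (snd x) \<omega> = fst x) * r1 x \<omega>)
          + ennreal (of_bool (e2 (fst x) (snd x) \<omega> = snd x) * r2 x \<omega>) \<partial>block_meas n)
        = (\<Sum>x\<in>A. \<integral>\<^sup>+\<omega>. ennreal (of_bool (e1 (fst x) (snd x) \<omega> = fst x) * r1 x \<omega>) \<partial>block_meas n)
          + (\<Sum>x\<in>A. \<integral>\<^sup>+\<omega>. ennreal (of_bool (e2 (fst x) (snd x) \<omega> = snd x) * r2 x \<omega>) \<partial>block_meas n)"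
        using m by (simp add: nn_integral_add sum.distrib)
      also have "\<dots> \<le> 1 + 1" by (intro add_mono B1 B2)
      finally show ?thesis by simp
    qed
    fix x \<omega> assume x: "x \<in> A" and \<omega>: "\<omega> \<in> good (fst x) (snd x)"
    let ?r1 = "r1 x \<omega>" and ?r2 = "r2 x \<omega>"
    have nn: "?r1 \<ge> 0" "?r2 \<ge> 0" using r_nonneg[of "fst x" "snd x" \<omega>] by simp_all
    have "\<kappa> \<le> (1 / (v1 * v2)) ^ n * exp (- (8 * energy (fst x) (snd x) \<omega>)) / (real M1 * real M2)"
      unfolding \<kappa>_def using v1 v2 \<omega> by (intro divide_right_mono mult_left_mono) (auto simp: good_def)
    also have "\<dots> \<le> ?r1 * ?r2" using ratio[of "fst x" "snd x" \<omega>] by simp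
    finally have "2 * sqrt \<kappa> \<le> 2 * sqrt (?r1 * ?r2)" by simp
    also have "\<dots> \<le> ?r1 + ?r2" using arith_geo_mean_sqrt[OF nn] by simp
    finally show "ennreal (2 * sqrt \<kappa>) \<le> ennreal (of_bool (e1 (fst x) (snd x) \<omega> = fst x) * r1 x \<omega>)
      + ennreal (of_bool (e2 (fst x) (snd x) \<omega> = snd x) * r2 x \<omega>)"
      using \<omega> nn by (simp add: good_def ennreal_leI flip: ennreal_plus)
  qed (use \<kappa> in \<open>auto simp: A_def\<close>)
  moreover have "real M1 * real M2 / 2 \<le> (\<Sum>x\<in>A. prob (good (fst x) (snd x)))"
    using good_mass[OF n err] by (simp add: A_def sum.cartesian_product split_beta')
  ultimately have "(2 * sqrt \<kappa>) * (real M1 * real M2 / 2) \<le> 2"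
    using \<kappa> by (elim order_trans[rotated]) (intro mult_left_mono, auto)
  \<comment> \<open>Since \<open>\<kappa>\<close> contains \<open>1 / (M1 * M2)\<close>, squaring
    leaves exactly one factor \<open>M1 * M2\<close>.\<close>
  then have "(sqrt \<kappa> * (real M1 * real M2))\<^sup>2 \<le> 2\<^sup>2"
    using \<kappa> by (intro power_mono) auto
  then have "\<kappa> * (real M1 * real M2) * (real M1 * real M2) \<le> 4"
    using \<kappa> by (simp add: power_mult_distrib power2_eq_square[of "real _"] mult_ac)
  then have "(1 / (v1 * v2)) ^ n * exp (- (480 * real n)) * (real M1 * real M2) \<le> 4"
    using M_pos by (simp add: \<kappa>_def)
  then show ?thesis
    using v1 v2 by (simp add: exp_minus field_simps power_divide)
qed

end

section \<open>Passage to the sum capacity\<close>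

text \<open>The bound on the code size holds at every positive block length, so one code with error
  at most 1/4 decides; the factor 4 costs \<open>2 / n \<le> 2\<close> bits per symbol.\<close>

lemma achievable_sum_le:
  assumes ach: "achievable snr R1 R2" and B: "B > 0"
    and le: "\<And>n c. n > 0 \<Longrightarrow> valid_code snr n c \<Longrightarrow> err_prob snr n c \<le> 1/4
      \<Longrightarrow> real (nmsg1 c) * real (nmsg2 c) \<le> 4 * B ^ n"
  shows "R1 + R2 \<le> log 2 B + 2"
proof -
  from ach obtain N where N: "\<And>n. n \<ge> N \<Longrightarrow> \<exists>c. valid_code snr n c \<and>
        nmsg1 c = nat \<lceil>2 powr (real n * R1)\<rceil> \<and> nmsg2 c = nat \<lceil>2 powr (real n * R2)\<rceil> \<and>
        err_prob snr n c \<le> 1/4"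
    unfolding achievable_def by (meson zero_less_divide_1_iff zero_less_numeral)
  define n where "n = Suc N"
  obtain c where c: "valid_code snr n c" "err_prob snr n c \<le> 1/4"
    "nmsg1 c = nat \<lceil>2 powr (real n * R1)\<rceil>" "nmsg2 c = nat \<lceil>2 powr (real n * R2)\<rceil>"
    using N[of n] by (auto simp: n_def)
  have "2 powr (real n * (R1 + R2)) = 2 powr (real n * R1) * 2 powr (real n * R2)"
    by (simp add: distrib_left powr_add)
  also have "\<dots> \<le> real (nmsg1 c) * real (nmsg2 c)"
    unfolding c by (intro mult_mono real_nat_ceiling_ge powr_ge_zero of_nat_0_le_iff)
  also have "\<dots> \<le> 4 * B ^ n"
    using c by (intro le) (auto simp: n_def)
  also have "\<dots> = 2 powr (2 + real n * log 2 B)"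
    using B by (simp add: powr_add powr_powr[symmetric] mult.commute[of "real n"] powr_realpow)
  finally have "real n * (R1 + R2) \<le> 2 + real n * log 2 B" by simp
  also have "\<dots> \<le> real n * (log 2 B + 2)" by (simp add: n_def algebra_simps)
  finally show ?thesis by (simp add: n_def)
qed

text \<open>The half-plane below the line \<open>R1 + R2 = T\<close> is convex, so it contains the
  convex hull of the achievable pairs along with these pairs.\<close>

lemma Csum_le:
  assumes "\<And>R1 R2. achievable snr R1 R2 \<Longrightarrow> R1 + R2 \<le> T"
  shows "Csum snr \<le> ereal T"
proof -
  have "capacity_region snr \<subseteq> {p. (1, 1) \<bullet> p \<le> T}"
    unfolding capacity_region_def
    by (rule hull_minimal) (use assms in \<open>auto simp: convex_halfspace_le\<close>)
  then show ?thesis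
    unfolding Csum_def by (intro SUP_least) (auto simp: inner_prod_def)
qed

theorem theorem4:
  fixes \<alpha> \<beta> \<gamma> lam :: real
  assumes "\<alpha> \<ge> 0" and "\<beta> \<ge> 0" and "\<gamma> \<ge> 0" and "lam \<ge> 0"
    and "\<beta> > 2 * lam + 1"
  shows "Limsup at_top (\<lambda>s. Csum (zicr_snr s \<alpha> \<beta> \<gamma> lam) / ereal (log 2 s))
           \<le> ereal (min (max 2 (1 + min \<beta> \<gamma>))
                        (max (\<alpha> + lam) (max \<beta> (1 + \<beta> - \<alpha> - lam))))"
proof -
  define EA where "EA = max 2 (1 + min \<beta> \<gamma>)"
  define EB where "EB = max (\<alpha> + lam) (max \<beta> (1 + \<beta> - \<alpha> - lam))"
  \<comment> \<open>Covers the largest constants met below, \<open>exp 480\<close> and the factor 2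
    in \<open>v1\<close>, plus the 2 bits of \<open>achievable_sum_le\<close>.\<close>
  define C where "C = log 2 (2 * exp 480) + 2"
  have bound: "R1 + R2 \<le> min EA EB * log 2 s + C"
    if s: "s > 1" and ach: "achievable (zicr_snr s \<alpha> \<beta> \<gamma> lam) R1 R2" for s R1 R2
  proof -
    let ?snr = "zicr_snr s \<alpha> \<beta> \<gamma> lam"
    have snr: "?snr L11 = s powr 1" "?snr L22 = s powr 1" "?snr L21 = s powr \<alpha>" "?snr L32 = s powr lam"
      "?snr L13 = s powr \<gamma>" "?snr L31 = s powr \<beta>"
      using s by (simp_all add: zicr_snr_def)
    have snr_ge_1: "1 \<le> ?snr l" for l
      using s assms by (cases l) (simp_all add: zicr_snr_def ge_one_powr_ge_zero)
    have log_le: "log 2 (s powr e * exp d * k) + 2 \<le> E * log 2 s + C" if "e \<le> E" "d \<le> 480" "1 \<le> k" "k \<le> 2" for e E d k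
    proof -
      have "exp d * k \<le> exp 480 * 2" using that by (intro mult_mono) auto
      then have "log 2 (exp d * k) \<le> log 2 (2 * exp 480)"
        using that by (subst log_le_cancel_iff) (auto simp: mult.commute)
      moreover have "e * log 2 s \<le> E * log 2 s"
        using that s by (intro mult_right_mono) auto
      moreover have "log 2 (s powr e * exp d * k) = e * log 2 s + log 2 (exp d * k)"
        using s that by (simp add: log_mult log_powr mult.assoc)
      ultimately show ?thesis by (simp add: C_def)
    qed
    \<comment> \<open>The exponent for user 1: of the cuts with exponents
      \<open>max 1 \<beta>\<close> and \<open>max 1 \<gamma>\<close> the smaller one is used. User 2
      adds 1, and the constants add up to \<open>360 = 240 + 120\<close>.\<close>
    define ea where "ea = max 1 (min \<beta> \<gamma>)"
    have "R1 + R2 \<le> log 2 (s powr (1 + ea) * exp 360 * 1) + 2"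
    proof (rule achievable_sum_le[OF ach])
      fix n c assume n: "n > (0::nat)" and c: "valid_code ?snr n c" "err_prob ?snr n c \<le> 1/4"
      interpret zicr_code ?snr n c by unfold_locales (use c snr_ge_1 in auto)
      have "real M1 \<le> 2 * (s powr ea) ^ n * exp (240 * n)"
      proof (cases "\<beta> \<le> \<gamma>")
        case True
        then have "s powr 1 \<le> s powr ea" "s powr \<beta> \<le> s powr ea"
          using s by (intro powr_mono; simp add: ea_def)+
        then show ?thesis
          by (intro nmsg1_le_relay_to_receiver n c) (simp_all only: snr)
      next
        case \<beta>\<gamma>: False
        define L where "L k = (if k = N1 then L11 else L13)" for k
        show ?thesis
        \<comment> \<open>The stronger look at \<open>X1\<close> is the relay's if
          \<open>\<gamma> \<ge> 1\<close> and receiver 1's own otherwise.\<close>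
        proof (cases "\<gamma> \<ge> 1")
          case True
          then show ?thesis
            using nmsg1_le_two_looks[OF n c(2), of N3 N1 L] powr_mono[of 1 \<gamma> s] \<beta>\<gamma> s by (auto simp: L_def snr ea_def insert_commute)
        next
          case False
          then show ?thesis
            using nmsg1_le_two_looks[OF n c(2), of N1 N3 L] powr_mono[of \<gamma> 1 s] \<beta>\<gamma> s by (auto simp: L_def snr ea_def)
        qed
      qed
      then have "real M1 * real M2 \<le> (2 * (s powr ea) ^ n * exp (240 * n)) * (2 * ?snr L22 ^ n * exp (120 * n))"
        by (intro mult_mono nmsg2_le n c) auto
      also have "\<dots> = 4 * (s powr (1 + ea) * exp 360 * 1) ^ n"
        unfolding snr by (simp add: powr_add power_mult_distrib exp_of_nat_mult[symmetric] mult_ac flip: exp_add)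
      finally show "real M1 * real M2 \<le> 4 * (s powr (1 + ea) * exp 360 * 1) ^ n" .
    qed (use s in simp)
    also have "\<dots> \<le> EA * log 2 s + C"
      by (rule log_le) (auto simp: ea_def EA_def)
    finally have A: "R1 + R2 \<le> EA * log 2 s + C" .
    \<comment> \<open>The sum \<open>x + y\<close> is the maximum of \<open>\<alpha> + lam\<close>,
      \<open>\<alpha> + (1 - \<alpha>) = 1\<close>, \<open>(\<beta> - lam) + lam = \<beta>\<close>
      and \<open>1 + \<beta> - \<alpha> - lam\<close>. From \<open>\<beta> > 2 * lam + 1\<close> one
      gets \<open>\<beta> - lam > 1\<close>, so that the direct link stays within exponent
      \<open>x\<close>, and \<open>\<beta> > 1\<close>, so that the term 1 is absorbed.\<close>
    define x where "x = max \<alpha> (\<beta> - lam)"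
    define y where "y = max lam (1 - \<alpha>)"
    have "R1 + R2 \<le> log 2 (s powr (x + y) * exp 480 * 2) + 2"
    proof (rule achievable_sum_le[OF ach])
      fix n c assume n: "n > (0::nat)" and c: "valid_code ?snr n c" "err_prob ?snr n c \<le> 1/4"
      interpret zicr_code ?snr n c by unfold_locales (use c snr_ge_1 in auto)
      have "real M1 * real M2 \<le> 4 * ((2 * s powr x) * s powr y) ^ n * exp (480 * n)"
      proof (rule nmsg_prod_le[OF n c(2)])
        show "2 \<le> 2 * s powr x" "1 \<le> s powr y"
          using s assms by (auto simp: x_def y_def ge_one_powr_ge_zero)
        have "s powr 1 \<le> s powr x"
          using s assms by (intro powr_mono) (auto simp: x_def)
        then show "2 * ?snr L11 \<le> 2 * s powr x" "2 * ?snr L21 \<le> 2 * s powr x" "?snr L32 \<le> s powr y"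
          unfolding snr using s assms by (auto simp: x_def y_def)
        show "2 * (?snr L31 / ?snr L32) \<le> 2 * s powr x" "?snr L22 / ?snr L21 \<le> s powr y"
          unfolding snr powr_diff[symmetric] using s by (auto simp: x_def y_def)
      qed
      also have "\<dots> = 4 * (s powr (x + y) * exp 480 * 2) ^ n"
        by (simp add: powr_add power_mult_distrib exp_of_nat_mult[symmetric] mult_ac)
      finally show "real M1 * real M2 \<le> 4 * (s powr (x + y) * exp 480 * 2) ^ n" .
    qed (use s in simp)
    also have "\<dots> \<le> EB * log 2 s + C"
      by (rule log_le) (use assms in \<open>auto simp: x_def y_def EB_def\<close>)
    finally show ?thesis using A by (simp add: min_def)
  qed
  \<comment> \<open>The gap \<open>C\<close> is the same for all \<open>s > 1\<close>;
    \<open>C * ln 2 / ln s\<close> is \<open>C / log 2 s\<close>, rewritten for the limit.\<close>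
  have "Limsup at_top (\<lambda>s. Csum (zicr_snr s \<alpha> \<beta> \<gamma> lam) / ereal (log 2 s))
      \<le> Limsup at_top (\<lambda>s. ereal (min EA EB + C * ln 2 / ln s))"
  proof (rule Limsup_mono)
    show "\<forall>\<^sub>F s in at_top. Csum (zicr_snr s \<alpha> \<beta> \<gamma> lam) / ereal (log 2 s) \<le> ereal (min EA EB + C * ln 2 / ln s)"
      using eventually_gt_at_top[of "1::real"]
    proof eventually_elim
      case (elim s)
      then have l: "log 2 s > 0" by simp
      have "Csum (zicr_snr s \<alpha> \<beta> \<gamma> lam) / ereal (log 2 s) \<le> ereal (min EA EB * log 2 s + C) / ereal (log 2 s)"
        using l bound[OF elim] by (intro ereal_divide_right_mono Csum_le) auto
      also have "\<dots> = ereal (min EA EB + C * ln 2 / ln s)"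
        using l elim by (simp add: log_def field_simps)
      finally show ?case .
    qed
  qed
  also have "\<dots> = ereal (min EA EB)"
  proof (rule lim_imp_Limsup)
    have "((\<lambda>s::real. C * ln 2 / ln s) \<longlongrightarrow> 0) at_top"
      by (rule tendsto_divide_0[OF tendsto_const filterlim_at_top_imp_at_infinity[OF ln_at_top]])
    from tendsto_add[OF tendsto_const this, of "min EA EB"]
    have "((\<lambda>s. min EA EB + C * ln 2 / ln s) \<longlongrightarrow> min EA EB) at_top"
      by simp
    then show "((\<lambda>s. ereal (min EA EB + C * ln 2 / ln s)) \<longlongrightarrow> ereal (min EA EB)) at_top"
      by (rule tendsto_ereal)
  qed simp
  finally show ?thesis by (simp only: EA_def EB_def)
qed

end
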